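(* Let $U:\mathbb{R}^d\to\mathbb{R}$ satisfy (A1), (A2), (A3) of the context, with constants $L$, $K$, $\mathcal{R}$, and let $T\in(0,\infty)$ satisfy $$LT^2\le\min\left(\frac{K}{L},\frac14,\frac{1}{256\,L\mathcal{R}^2}\right).$$ Put $\gamma=\min(T^{-1},\mathcal{R}^{-1}/4)$, $a=T^{-1}$, $R_1=\frac52(\mathcal{R}+T)$ and $f(r)=\int_0^r\exp(-a\min(s,R_1))\,ds$ for $r\ge 0$. Let $(X'(x,y),Y'(x,y))$ be the coupling of two exact HMC transition steps described in the context (with this $\gamma$), and let $r(x,y)=|x-y|$, $R'(x,y)=|X'(x,y)-Y'(x,y)|$. Then for all $x,y\in\mathbb{R}^d$, $$E[f(R'(x,y))]\le(1-c)\,f(r(x,y)),$$ where $$c=\frac1{10}\min\left(1,\ \frac12KT^2\Big(1+\frac{\mathcal{R}}{T}\Big)e^{-\mathcal{R}/(2T)}\right)e^{-2\mathcal{R}/T}.$$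
   Context: Assumptions on $U$: $U\in C^4(\mathbb{R}^d)$ with $\int_{\mathbb{R}^d}e^{-U(x)}dx<\infty$, and (A1) $U$ has a local minimum at $0$ and $U(0)=0$; (A2) $U$ has bounded second, third and fourth derivatives; $L=\sup\|\nabla^2U\|$; (A3) there are constants $\mathcal{R}\in[0,\infty)$, $K\in(0,\infty)$ such that $(x-y)\cdot(\nabla U(x)-\nabla U(y))\ge K|x-y|^2$ for all $x,y\in\mathbb{R}^d$ with $|x-y|\ge\mathcal{R}$. Here $|\cdot|$ is the Euclidean norm. If $\mathcal{R}=0$, then $1/\mathcal{R}$ and $1/\mathcal{R}^2$ are read as $+\infty$. Exact Hamiltonian flow: $(q_t(x,v),p_t(x,v))$ solves $\frac{d}{dt}q_t=p_t$, $\frac{d}{dt}p_t=-\nabla U(q_t)$, $(q_0,p_0)=(x,v)$. The exact HMC transition step from $x$ is $X'(x)=q_T(x,\xi)$ with $\xi\sim N(0,I_d)$. Coupling: let $\xi\sim N(0,I_d)$ and $\tilde{\mathcal{U}}\sim\mathrm{Unif}(0,1)$ be independent. Put $X'(x,y)=q_T(x,\xi)$, $Y'(x,y)=q_T(y,\eta)$, where: - if $|x-y|\ge2\mathcal{R}$, then $\eta=\xi$ (synchronous coupling); - if $|x-y|<2\mathcal{R}$, then with $z=x-y$, $e=z/|z|$ and $\varphi_{0,1}$ the standard normal density on $\mathbb{R}$, $\eta=\xi+\gamma z$ if $\tilde{\mathcal{U}}\le\varphi_{0,1}(e\cdot\xi+\gamma|z|)/\varphi_{0,1}(e\cdot\xi)$,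 and $\eta=\xi-2(e\cdot\xi)e$ otherwise (for $z=0$ this gives $\eta=\xi$, whatever unit vector $e$ is used). *)

theory Defs
  imports "HOL-Analysis.Analysis" "HOL-Probability.Probability"
begin

primrec C_k :: "nat \<Rightarrow> ('a::euclidean_space \<Rightarrow> real) \<Rightarrow> bool" where
  "C_k 0 f \<longleftrightarrow> continuous_on UNIV f"
| "C_k (Suc k) f \<longleftrightarrow>
     (\<forall>x. f differentiable (at x)) \<and> (\<forall>v. C_k k (\<lambda>x. frechet_derivative f (at x) v))"

(* iter_deriv f [v1, ..., vk] x is D^k f(x)[v1, ..., vk], the k-th derivative at x as a k-linear form. *)
primrec iter_deriv :: "('a::euclidean_space \<Rightarrow> real) \<Rightarrow> 'a list \<Rightarrow> 'a \<Rightarrow> real" where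
  "iter_deriv f [] = f"
| "iter_deriv f (v # vs) = (\<lambda>x. frechet_derivative (iter_deriv f vs) (at x) v)"

(* The multilinear operator norm of D^k f(x) is bounded uniformly in x. *)
definition bounded_kth_deriv :: "nat \<Rightarrow> ('a::euclidean_space \<Rightarrow> real) \<Rightarrow> bool" where
  "bounded_kth_deriv k f \<longleftrightarrow>
     (\<exists>B. \<forall>x vs. length vs = k \<longrightarrow> \<bar>iter_deriv f vs x\<bar> \<le> B * (\<Prod>v\<leftarrow>vs. norm v))"

definition gradient :: "('a::euclidean_space \<Rightarrow> real) \<Rightarrow> 'a \<Rightarrow> 'a" where
  "gradient f x = (THE g. GDERIV f x :> g)"

definition hessian :: "('a::euclidean_space \<Rightarrow> real) \<Rightarrow> 'a \<Rightarrow> 'a \<Rightarrow> 'a" where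
  "hessian f x = frechet_derivative (gradient f) (at x)"

definition assm_A1 :: "('a::euclidean_space \<Rightarrow> real) \<Rightarrow> bool" where
  "assm_A1 U \<longleftrightarrow> (\<forall>\<^sub>F x in nhds 0. U 0 \<le> U x) \<and> U 0 = 0"

definition assm_A2 :: "('a::euclidean_space \<Rightarrow> real) \<Rightarrow> real \<Rightarrow> bool" where
  "assm_A2 U L \<longleftrightarrow>
     bounded_kth_deriv 2 U \<and> bounded_kth_deriv 3 U \<and> bounded_kth_deriv 4 U \<and>
     L = (SUP x. onorm (hessian U x))"

definition assm_A3 :: "('a::euclidean_space \<Rightarrow> real) \<Rightarrow> real \<Rightarrow> real \<Rightarrow> bool" where
  "assm_A3 U K R \<longleftrightarrow> 0 \<le> R \<and> 0 < K \<and>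
     (\<forall>x y. norm (x - y) \<ge> R \<longrightarrow>
        (x - y) \<bullet> (gradient U x - gradient U y) \<ge> K * (norm (x - y))\<^sup>2)"

definition hamiltonian_flow ::
  "('a::euclidean_space \<Rightarrow> real) \<Rightarrow> (real \<Rightarrow> 'a \<Rightarrow> 'a \<Rightarrow> 'a) \<Rightarrow> (real \<Rightarrow> 'a \<Rightarrow> 'a \<Rightarrow> 'a) \<Rightarrow> bool" where
  "hamiltonian_flow U q p \<longleftrightarrow>
     (\<forall>x v. q 0 x v = x \<and> p 0 x v = v \<and>
       (\<forall>t\<ge>0. ((\<lambda>s. q s x v) has_vector_derivative p t x v) (at t within {0..}) \<and>
              ((\<lambda>s. p s x v) has_vector_derivative - gradient U (q t x v)) (at t within {0..})))"

(* Density of N(0, I_d): the coordinates are independent standard normals. *)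
definition std_gaussian_density :: "'a::euclidean_space \<Rightarrow> real" where
  "std_gaussian_density v = (\<Prod>b\<in>Basis. std_normal_density (v \<bullet> b))"

(* Joint law of the initial velocity and the uniform variable.  Independence is stated
   through the generated events because indep_var needs a common value type. *)
definition coupling_noise ::
  "'w measure \<Rightarrow> ('w \<Rightarrow> 'a::euclidean_space) \<Rightarrow> ('w \<Rightarrow> real) \<Rightarrow> bool" where
  "coupling_noise M \<xi> u \<longleftrightarrow>
     prob_space M \<and>
     distributed M lborel \<xi> (\<lambda>v. ennreal (std_gaussian_density v)) \<and>
     distributed M lborel u (indicator {0<..<1}) \<and>
     prob_space.indep_set M {\<xi> -` A \<inter> space M |A. A \<in> sets borel}
                            {u -` B \<inter> space M |B. B \<in> sets borel}"

(* The second initial velocity as a function of the first one, w, and of the uniform value s.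
   Here sgn z = z / |z|, and sgn 0 = 0, so that the result is w when x = y. *)
definition coupled_velocity ::
  "real \<Rightarrow> real \<Rightarrow> 'a::euclidean_space \<Rightarrow> 'a \<Rightarrow> 'a \<Rightarrow> real \<Rightarrow> 'a" where
  "coupled_velocity R \<gamma> x y w s =
     (let z = x - y; e = sgn z in
      if norm z \<ge> 2 * R then w
      else if s \<le> std_normal_density (e \<bullet> w + \<gamma> * norm z) / std_normal_density (e \<bullet> w)
      then w + \<gamma> *\<^sub>R z
      else w - (2 * (e \<bullet> w)) *\<^sub>R e)"

end

theory Submission
  imports Defs
begin

text \<open>
  Let \<open>r = |x - y|\<close>. The two branches of the coupling contract for different reasons.

  If \<open>r \<ge> 2R\<close>, both copies start with the same velocity. As \<open>L T\<^sup>2 \<le> 1/4\<close>, the difference \<open>z\<close> of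
  the two trajectories keeps at least \<open>6/7\<close> of its length up to time \<open>T\<close>, so it stays where the
  potential is strongly convex. There \<open>|z|\<^sup>2\<close> is pushed down by \<open>2 K |z|\<^sup>2\<close> in second derivative,
  against a kinetic term \<open>2 |z'|\<^sup>2\<close>, which is controlled by \<open>L\<^sup>2 T\<^sup>2 \<le> K\<close>. Two integrations
  give \<open>|z(T)| \<le> (1 - K T\<^sup>2 / 4) r\<close> (\<open>contraction\<close>). Concavity of \<open>f\<close> turns this into a decrease
  of \<open>f\<close> by at least \<open>(K T\<^sup>2 / 4) r f'(r)\<close>, and \<open>r f'(r) / f(r)\<close> is smallest at
  \<open>r = R\<^sub>1\<close>, where \<open>f\<close> becomes linear (\<open>profile_slope_ratio\<close>).

  If \<open>0 < r < 2R\<close>, the second velocity is usually the first one translated by \<open>\<gamma> (x - y)\<close>. Free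
  flight would then bring the distance down to \<open>(1 - \<gamma> T) r\<close>, and the force changes this by at most
  \<open>L T\<^sup>2 r \<le> \<gamma> T r / 4\<close>. The translation is rejected with probability at most \<open>(2/5) \<gamma> r \<le> 1/5\<close>;
  the velocity is then reflected, and the distance may grow. But \<open>f'\<close> decays at rate \<open>1/T\<close> up to
  \<open>R\<^sub>1\<close>, so that \<open>f\<close> cannot gain more than \<open>T f'(r)\<close> before \<open>R\<^sub>1\<close>. Beyond \<open>R\<^sub>1\<close> it grows linearly,
  but with the tiny slope \<open>exp (- R\<^sub>1 / T)\<close>, and \<open>R\<^sub>1\<close> is so large that it is exceeded only if the
  normal variable \<open>\<sigma> = e \<bullet> \<xi>\<close> exceeds \<open>1\<close>. In units of \<open>\<gamma> T r f'(r)\<close> the balance is a loss of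
  \<open>3/4 * 4/5 = 3/5\<close> against gains of \<open>2/5\<close> and \<open>1/8\<close> (\<open>reflection_coupling_contraction\<close>).

  The randomness enters only through \<open>\<sigma>\<close>, which is standard normal and independent of the
  uniform variable, so the expectation is a one-dimensional Gaussian integral.
\<close>

section \<open>One-dimensional marginals of the Gaussian velocity\<close>

text \<open>
  The density is a product over coordinates, so both measures agree on boxes, and boxes determine
  a finite product measure.
\<close>

lemma distributed_marginals_std_gaussian:
  fixes \<xi> :: "'w \<Rightarrow> 'a::euclidean_space"
  assumes "prob_space M" and D: "distributed M lborel \<xi> (\<lambda>v. ennreal (std_gaussian_density v))"
  shows "distr M (PiM Basis (\<lambda>_. borel)) (\<lambda>\<omega>. \<lambda>b\<in>Basis. \<xi> \<omega> \<bullet> b)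
    = PiM Basis (\<lambda>_. density lborel (\<lambda>x. ennreal (std_normal_density x)))" (is "?D = PiM Basis (\<lambda>_. ?N)")
proof -
  interpret prob_space M by fact
  have \<xi>[measurable]: "\<xi> \<in> measurable M borel"
    using distributed_measurable[OF D] by simp
  have sets_N[measurable_cong]: "sets ?N = sets borel" by simp
  interpret N: prob_space ?N using prob_space_normal_density[of 1 0] by simp
  interpret product_sigma_finite "\<lambda>_::'a. ?N" ..
  show ?thesis
  proof (rule PiM_eqI)
    show "sets ?D = sets (PiM Basis (\<lambda>_. ?N))"
      by (simp cong: sets_PiM_cong)
    fix A assume A: "\<And>i::'a. i \<in> Basis \<Longrightarrow> A i \<in> sets ?N"
    then have [measurable]: "A i \<in> sets borel" if "i \<in> Basis" for i using that by simp
    have "emeasure ?D (Pi\<^sub>E Basis A) = emeasure M (\<xi> -` {v. \<forall>b\<in>Basis. v \<bullet> b \<in> A b} \<inter> space M)"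
      by (subst emeasure_distr) (auto intro!: arg_cong[where f="emeasure M"] sets_PiM_I_finite)
    also have "\<dots> = (\<integral>\<^sup>+v. ennreal (std_gaussian_density v) * indicator {v. \<forall>b\<in>Basis. v \<bullet> b \<in> A b} v \<partial>lborel)"
      by (rule distributed_emeasure[OF D]) measurable
    also have "\<dots> = (\<integral>\<^sup>+v. (\<Prod>b\<in>Basis. ennreal (std_normal_density (v \<bullet> b)) * indicator (A b) (v \<bullet> b)) \<partial>lborel)"
      by (intro nn_integral_cong)
         (auto simp: std_gaussian_density_def prod.distrib prod_ennreal indicator_def
            normal_density_nonneg cong: prod.cong)
    also have "\<dots> = (\<Prod>b\<in>Basis. \<integral>\<^sup>+x. ennreal (std_normal_density x) * indicator (A b) x \<partial>lborel)"
      by (rule nn_integral_lborel_prod) auto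
    also have "\<dots> = (\<Prod>b\<in>Basis. emeasure ?N (A b))"
      by (intro prod.cong) (auto simp: emeasure_density)
    finally show "emeasure ?D (Pi\<^sub>E Basis A) = (\<Prod>b\<in>Basis. emeasure ?N (A b))" .
  qed simp
qed

lemma std_gaussian_coordinates:
  fixes \<xi> :: "'w \<Rightarrow> 'a::euclidean_space"
  assumes M: "prob_space M" and D: "distributed M lborel \<xi> (\<lambda>v. ennreal (std_gaussian_density v))"
  shows "b \<in> Basis \<Longrightarrow> distributed M lborel (\<lambda>\<omega>. \<xi> \<omega> \<bullet> b) (\<lambda>x. ennreal (std_normal_density x))"
    and "prob_space.indep_vars M (\<lambda>_. borel) (\<lambda>b \<omega>. \<xi> \<omega> \<bullet> b) Basis"
proof -
  interpret prob_space M by fact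
  let ?N = "density lborel (\<lambda>x. ennreal (std_normal_density x))"
  have \<xi>[measurable]: "\<xi> \<in> measurable M borel"
    using distributed_measurable[OF D] by simp
  interpret N: prob_space ?N using prob_space_normal_density[of 1 0] by simp
  interpret P: product_prob_space "\<lambda>_::'a. ?N" Basis ..
  have distr_b: "distr M borel (\<lambda>\<omega>. \<xi> \<omega> \<bullet> b) = ?N" if "b \<in> Basis" for b
  proof -
    have "distr M borel (\<lambda>\<omega>. \<xi> \<omega> \<bullet> b)
        = distr (distr M (PiM Basis (\<lambda>_. borel)) (\<lambda>\<omega>. \<lambda>b\<in>Basis. \<xi> \<omega> \<bullet> b)) borel (\<lambda>f. f b)"
      using that by (subst distr_distr) (auto simp: comp_def)
    also have "\<dots> = distr (PiM Basis (\<lambda>_. ?N)) ?N (\<lambda>f. f b)"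
      using distributed_marginals_std_gaussian[OF assms] by (simp cong: distr_cong)
    also have "\<dots> = ?N" using that by (rule P.PiM_component)
    finally show ?thesis .
  qed
  then show "b \<in> Basis \<Longrightarrow> distributed M lborel (\<lambda>\<omega>. \<xi> \<omega> \<bullet> b) (\<lambda>x. ennreal (std_normal_density x))"
    by (simp add: distributed_def cong: distr_cong)
  show "indep_vars (\<lambda>_. borel) (\<lambda>b \<omega>. \<xi> \<omega> \<bullet> b) Basis"
    using distributed_marginals_std_gaussian[OF assms]
    by (subst indep_vars_iff_distr_eq_PiM) (auto simp: distr_b cong: PiM_cong)
qed

text \<open>
  \<open>e \<bullet> \<xi>\<close> is a sum of independent centred normals with standard deviations \<open>|e \<bullet> b|\<close>, whose variances
  add up to \<open>|e|\<^sup>2 = 1\<close>. Basis vectors orthogonal to \<open>e\<close> are left out of the sum, since they would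
  contribute degenerate normals.
\<close>

lemma std_gaussian_projection:
  fixes \<xi> :: "'w \<Rightarrow> 'a::euclidean_space"
  assumes M: "prob_space M" and D: "distributed M lborel \<xi> (\<lambda>v. ennreal (std_gaussian_density v))"
    and e: "norm e = 1"
  shows "distributed M lborel (\<lambda>\<omega>. e \<bullet> \<xi> \<omega>) (\<lambda>x. ennreal (std_normal_density x))"
proof -
  interpret prob_space M by fact
  define I where "I = {b\<in>Basis. e \<bullet> b \<noteq> 0}"
  have "finite I" by (simp add: I_def)
  have sum_I: "(\<Sum>b\<in>I. g b) = (\<Sum>b\<in>Basis. g b)" if "\<And>b. e \<bullet> b = 0 \<Longrightarrow> g b = (0::real)" for g
    using that by (intro sum.mono_neutral_left) (auto simp: I_def)
  have "I \<noteq> {}"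
  proof
    assume "I = {}"
    then have "e = 0" by (auto simp: I_def intro: euclidean_eqI)
    with e show False by simp
  qed
  have X: "distributed M lborel (\<lambda>\<omega>. (e \<bullet> b) * (\<xi> \<omega> \<bullet> b)) (normal_density 0 \<bar>e \<bullet> b\<bar>)" if "b \<in> I" for b
    using normal_density_affine[OF std_gaussian_coordinates(1)[OF M D], of b "e \<bullet> b" 0] that
    by (simp add: I_def)
  have "indep_vars (\<lambda>_. borel) (\<lambda>b \<omega>. \<xi> \<omega> \<bullet> b) I"
    by (rule indep_vars_subset[OF std_gaussian_coordinates(2)[OF M D]]) (auto simp: I_def)
  then have "indep_vars (\<lambda>_. borel) (\<lambda>b \<omega>. (e \<bullet> b) * (\<xi> \<omega> \<bullet> b)) I"
    by (rule indep_vars_compose2) simp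
  from sum_indep_normal[OF \<open>finite I\<close> \<open>I \<noteq> {}\<close> this _ X]
  have "distributed M lborel (\<lambda>\<omega>. \<Sum>b\<in>I. (e \<bullet> b) * (\<xi> \<omega> \<bullet> b))
      (normal_density 0 (sqrt (\<Sum>b\<in>I. \<bar>e \<bullet> b\<bar>\<^sup>2)))"
    by (simp add: I_def)
  moreover have "(\<Sum>b\<in>I. (e \<bullet> b) * (v \<bullet> b)) = e \<bullet> v" for v
    by (subst sum_I) (auto simp: euclidean_inner[of e v])
  moreover have "(\<Sum>b\<in>I. \<bar>e \<bullet> b\<bar>\<^sup>2) = 1"
    using e by (subst sum_I) (auto simp: norm_eq_1 euclidean_inner[of e e] power2_eq_square)
  ultimately show ?thesis by simp
qed

section \<open>The rejected part of the translated Gaussian\<close>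

lemma std_normal_density_le_iff: "std_normal_density x \<le> std_normal_density y \<longleftrightarrow> \<bar>y\<bar> \<le> \<bar>x\<bar>"
proof -
  have "std_normal_density x \<le> std_normal_density y \<longleftrightarrow> exp (- x\<^sup>2 / 2) \<le> exp (- y\<^sup>2 / 2)"
    unfolding std_normal_density_def by (rule mult_le_cancel_left_pos) simp
  then show ?thesis by (simp add: abs_le_square_iff)
qed

lemma std_normal_density_le: "std_normal_density x \<le> 2/5"
proof -
  have "(5/2)\<^sup>2 \<le> 2 * pi" using pi_approx by (simp add: power2_eq_square)
  then have "5/2 \<le> sqrt (2 * pi)" by (rule real_le_rsqrt)
  then have "1 / sqrt (2 * pi) \<le> 1 / (5/2)" by (intro divide_left_mono) auto
  moreover have "exp (- x\<^sup>2 / 2) \<le> 1" by simp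
  ultimately have "1 / sqrt (2 * pi) * exp (- x\<^sup>2 / 2) \<le> 2/5 * 1"
    by (intro mult_mono) auto
  then show ?thesis by (simp add: std_normal_density_def)
qed

lemma integrable_std_normal_indicator:
  assumes [measurable]: "A \<in> sets borel"
  shows "integrable lborel (\<lambda>s. indicator A s * std_normal_density s)"
  by (rule Bochner_Integration.integrable_bound[OF integrable_normal_density[of 1 0]])
     (auto split: split_indicator)

lemma integral_std_normal_shift:
  fixes w :: "real \<Rightarrow> real"
  assumes "integrable lborel (\<lambda>s. w (s - h) * std_normal_density s)"
  shows "integrable lborel (\<lambda>s. w s * std_normal_density (s + h))"
    and "(\<integral>s. w s * std_normal_density (s + h) \<partial>lborel) = (\<integral>s. w (s - h) * std_normal_density s \<partial>lborel)"
  using lborel_integrable_real_affine[OF assms, of 1 h]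
    lborel_integral_real_affine[of 1 "\<lambda>s. w (s - h) * std_normal_density s" h]
  by (simp_all add: add.commute)

text \<open>
  The density can exceed its translate only on \<open>s > - h/2\<close>, so \<open>\<integral>E\<close> is the total variation distance
  of the two Gaussians. After a shift of the second term it becomes the mass of
  the interval from \<open>- h/2\<close> to \<open>h/2\<close>.
\<close>

lemma std_normal_excess_mass:
  assumes h: "h \<ge> 0"
  defines "E \<equiv> \<lambda>s. indicator {-h/2<..} s * (std_normal_density s - std_normal_density (s + h))"
  shows "integrable lborel E" and "(\<integral>s. E s \<partial>lborel) \<le> 2/5 * h"
proof -
  have int: "integrable lborel (\<lambda>s. indicator {c<..} s * std_normal_density s)" for c :: real
    by (rule integrable_std_normal_indicator) simp
  have sh: "indicator {-h/2<..} (s - h) = (indicator {h/2<..} s :: real)" for s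
    by (auto split: split_indicator)
  note S = integral_std_normal_shift[of "indicator {-h/2<..}" h, unfolded sh, OF int]
  have E: "E = (\<lambda>s. indicator {-h/2<..} s * std_normal_density s
      - indicator {-h/2<..} s * std_normal_density (s + h))"
    by (simp add: E_def algebra_simps)
  show "integrable lborel E" unfolding E by (intro Bochner_Integration.integrable_diff int S)
  have "(\<integral>s. E s \<partial>lborel) = (\<integral>s. indicator {-h/2<..} s * std_normal_density s \<partial>lborel)
      - (\<integral>s. indicator {h/2<..} s * std_normal_density s \<partial>lborel)"
    unfolding E by (simp only: Bochner_Integration.integral_diff[OF int S(1)] S(2))
  also have "\<dots> = (\<integral>s. indicator {-h/2<..} s * std_normal_density s
      - indicator {h/2<..} s * std_normal_density s \<partial>lborel)"
    by (rule Bochner_Integration.integral_diff[OF int int, symmetric])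
  also have "\<dots> \<le> (\<integral>s. 2/5 * indicator {-h/2..h/2} s \<partial>lborel)"
    using h std_normal_density_le
    by (intro integral_mono Bochner_Integration.integrable_diff int) (auto split: split_indicator)
  also have "\<dots> = 2/5 * h" using h by simp
  finally show "(\<integral>s. E s \<partial>lborel) \<le> 2/5 * h" .
qed

text \<open>
  After a shift of the second term the integral becomes the mean of
  \<open>max 0 (s - 1) - max 0 (s - 1 - h)\<close>. This is at most \<open>h\<close> on \<open>s \<ge> 1\<close> and zero elsewhere, hence at most
  \<open>h (s + 1)\<^sup>2 / 4\<close>, which has mean \<open>h / 2\<close> by the first two moments.
\<close>

lemma std_normal_excess_tail:
  assumes h: "h \<ge> 0"
  defines "E \<equiv> \<lambda>s. max 0 (s - 1) * (std_normal_density s - std_normal_density (s + h))"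
  shows "integrable lborel E" and "(\<integral>s. E s \<partial>lborel) \<le> h / 2"
proof -
  have P: "integrable lborel (\<lambda>s. (a + b * s + c * s\<^sup>2) * std_normal_density s)" for a b c :: real
    using integrable_std_normal_moment[of 0] integrable_std_normal_moment[of 1]
      integrable_std_normal_moment[of 2]
    by (simp add: distrib_right mult.assoc mult.commute[of "std_normal_density _"])
  have PI: "(\<integral>s. (a + b * s + c * s\<^sup>2) * std_normal_density s \<partial>lborel) = a + c" for a b c :: real
  proof -
    have 0: "has_bochner_integral lborel std_normal_density 1"
      using std_normal_moment_even[of 0] by simp
    have 1: "has_bochner_integral lborel (\<lambda>s. std_normal_density s * s) 0"
      using std_normal_moment_odd[of 0] by simp
    have 2: "has_bochner_integral lborel (\<lambda>s. std_normal_density s * s\<^sup>2) 1"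
      using std_normal_moment_even[of 1] by (simp add: eval_nat_numeral)
    have "has_bochner_integral lborel (\<lambda>s. a * std_normal_density s
        + b * (std_normal_density s * s) + c * (std_normal_density s * s\<^sup>2)) (a * 1 + b * 0 + c * 1)"
      by (intro has_bochner_integral_add has_bochner_integral_mult_right 0 1 2)
    then show ?thesis
      by (intro has_bochner_integral_integral_eq) (simp add: algebra_simps)
  qed
  have int: "integrable lborel (\<lambda>s. max 0 (s - c) * std_normal_density s)" for c :: real
  proof (rule Bochner_Integration.integrable_bound[OF P[of "\<bar>c\<bar> + 1" 0 1]])
    have "max 0 (s - c) \<le> \<bar>c\<bar> + 1 + s\<^sup>2" for s
    proof -
      have "0 \<le> (s - 1)\<^sup>2" by simp
      then have "2 * s \<le> 1 + s\<^sup>2" by (simp add: power2_eq_square algebra_simps)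
      moreover have "0 \<le> s\<^sup>2" by simp
      ultimately show ?thesis by linarith
    qed
    then show "AE s in lborel. norm (max 0 (s - c) * std_normal_density s)
        \<le> norm ((\<bar>c\<bar> + 1 + 0 * s + 1 * s\<^sup>2) * std_normal_density s)"
      by (auto simp: abs_mult intro!: mult_right_mono)
  qed simp
  have sh: "max 0 (s - h - 1) = max 0 (s - (1 + h))" for s by (simp add: algebra_simps)
  note S = integral_std_normal_shift[of "\<lambda>s. max 0 (s - 1)" h, unfolded sh, OF int]
  have E: "E = (\<lambda>s. max 0 (s - 1) * std_normal_density s - max 0 (s - 1) * std_normal_density (s + h))"
    by (simp add: E_def algebra_simps)
  show "integrable lborel E" unfolding E by (intro Bochner_Integration.integrable_diff int S)
  have "(\<integral>s. E s \<partial>lborel) = (\<integral>s. max 0 (s - 1) * std_normal_density s \<partial>lborel)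
      - (\<integral>s. max 0 (s - (1 + h)) * std_normal_density s \<partial>lborel)"
    unfolding E by (simp only: Bochner_Integration.integral_diff[OF int S(1)] S(2))
  also have "\<dots> = (\<integral>s. max 0 (s - 1) * std_normal_density s
      - max 0 (s - (1 + h)) * std_normal_density s \<partial>lborel)"
    by (rule Bochner_Integration.integral_diff[OF int int, symmetric])
  also have "\<dots> \<le> (\<integral>s. (h/4 + h/2 * s + h/4 * s\<^sup>2) * std_normal_density s \<partial>lborel)"
  proof (intro integral_mono Bochner_Integration.integrable_diff int P)
    fix s :: real
    have eq: "h/4 + h/2 * s + h/4 * s\<^sup>2 = h * ((s + 1)\<^sup>2 / 4)"
      by (simp add: power2_eq_square field_simps)
    have "max 0 (s - 1) - max 0 (s - (1 + h)) \<le> h * ((s + 1)\<^sup>2 / 4)"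
    proof (cases "s \<ge> 1")
      case True
      then have "2\<^sup>2 \<le> (s + 1)\<^sup>2" by (intro power_mono) auto
      then have "h * 1 \<le> h * ((s + 1)\<^sup>2 / 4)" using h by (intro mult_left_mono) auto
      then show ?thesis using h by (simp add: max_def)
    next
      case False
      then show ?thesis using h by (simp add: max_def)
    qed
    then show "max 0 (s - 1) * std_normal_density s - max 0 (s - (1 + h)) * std_normal_density s
        \<le> (h/4 + h/2 * s + h/4 * s\<^sup>2) * std_normal_density s"
      unfolding eq left_diff_distrib[symmetric] by (intro mult_right_mono) auto
  qed
  also have "\<dots> = h/4 + h/4" by (rule PI)
  finally show "(\<integral>s. E s \<partial>lborel) \<le> h / 2" by simp
qed

text \<open>
  The weight is the form in which the increase of \<open>f\<close> after a rejected translation is bounded: a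
  constant for the part below \<open>R\<^sub>1\<close>, and a linear part in the tail.
\<close>

lemma std_normal_excess_weighted:
  assumes h: "h \<ge> 0" and A: "A \<ge> 0" and B: "B \<ge> 0"
  shows "(\<integral>\<^sup>+s. ennreal ((A + B * max 0 (s - 1)) * max 0 (std_normal_density s - std_normal_density (s + h))) \<partial>lborel)
    \<le> ennreal (A * (2/5 * h) + B * (h / 2))"
proof -
  let ?E = "\<lambda>s. indicator {-h/2<..} s * (std_normal_density s - std_normal_density (s + h))"
  let ?F = "\<lambda>s. max 0 (s - 1) * (std_normal_density s - std_normal_density (s + h))"
  have eq: "(A + B * max 0 (s - 1)) * max 0 (std_normal_density s - std_normal_density (s + h)) = A * ?E s + B * ?F s"
    for s
  proof (cases "s > -h/2")
    case True
    then have "\<bar>s\<bar> \<le> \<bar>s + h\<bar>" using h by auto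
    then have "std_normal_density (s + h) \<le> std_normal_density s"
      by (simp add: std_normal_density_le_iff)
    with True show ?thesis by (simp add: max_def algebra_simps)
  next
    case False
    then have "\<bar>s + h\<bar> \<le> \<bar>s\<bar>" using h by auto
    then have "std_normal_density s \<le> std_normal_density (s + h)"
      by (simp add: std_normal_density_le_iff)
    with False h show ?thesis by (simp add: max_def)
  qed
  note E = std_normal_excess_mass[OF h] and F = std_normal_excess_tail[OF h]
  have I: "(\<integral>\<^sup>+s. ennreal (A * ?E s + B * ?F s) \<partial>lborel) = ennreal (\<integral>s. A * ?E s + B * ?F s \<partial>lborel)"
    using E(1) F(1)
  proof (intro nn_integral_eq_integral Bochner_Integration.integrable_add integrable_mult_right)
    show "AE s in lborel. 0 \<le> A * ?E s + B * ?F s"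
      unfolding eq[symmetric] using A B by (intro AE_I2 mult_nonneg_nonneg add_nonneg_nonneg) auto
  qed
  have "(\<integral>s. A * ?E s + B * ?F s \<partial>lborel) = A * (\<integral>s. ?E s \<partial>lborel) + B * (\<integral>s. ?F s \<partial>lborel)"
    using E(1) F(1) by simp
  also have "\<dots> \<le> A * (2/5 * h) + B * (h / 2)"
    using E(2) F(2) A B by (intro add_mono mult_left_mono)
  finally show ?thesis unfolding eq I by (rule ennreal_leI)
qed

text \<open>
  Given \<open>\<sigma> = s\<close>, rejection has conditional probability
  \<open>max 0 (1 - \<phi>(s + h) / \<phi>(s))\<close>; multiplied by the density \<open>\<phi>(s)\<close> this is the positive part of
  \<open>\<phi>(s) - \<phi>(s + h)\<close>.
\<close>

lemma nn_integral_rejection: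
  assumes "prob_space M"
    and S: "distributed M lborel \<sigma> (\<lambda>x. ennreal (std_normal_density x))"
    and D: "distributed M lborel u (indicator {0<..<1::real})"
    and ind: "prob_space.indep_var M borel \<sigma> borel u"
    and [measurable]: "k \<in> borel_measurable borel" and k: "\<And>s. 0 \<le> k s"
  shows "(\<integral>\<^sup>+\<omega>. ennreal (k (\<sigma> \<omega>)) * indicator {\<omega>. std_normal_density (\<sigma> \<omega> + h) / std_normal_density (\<sigma> \<omega>) < u \<omega>} \<omega> \<partial>M)
    = (\<integral>\<^sup>+s. ennreal (k s * max 0 (std_normal_density s - std_normal_density (s + h))) \<partial>lborel)"
proof -
  interpret prob_space M by fact
  let ?\<rho> = "\<lambda>s. std_normal_density (s + h) / std_normal_density s"
  define g :: "real \<times> real \<Rightarrow> ennreal" where "g = (\<lambda>(s,t). ennreal (k s) * indicator {t. ?\<rho> s < t} t)"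
  have [measurable]: "g \<in> borel_measurable (lborel \<Otimes>\<^sub>M lborel)" unfolding g_def by measurable
  have J: "distributed M (lborel \<Otimes>\<^sub>M lborel) (\<lambda>\<omega>. (\<sigma> \<omega>, u \<omega>))
      (\<lambda>(s,t). ennreal (std_normal_density s) * indicator {0<..<1} t)"
    using ind by (intro distributed_joint_indep S D lborel.sigma_finite_measure_axioms)
      (simp add: indep_var_eq)
  have "(\<integral>\<^sup>+\<omega>. ennreal (k (\<sigma> \<omega>)) * indicator {\<omega>. ?\<rho> (\<sigma> \<omega>) < u \<omega>} \<omega> \<partial>M)
      = (\<integral>\<^sup>+\<omega>. g (\<sigma> \<omega>, u \<omega>) \<partial>M)"
    by (simp add: g_def indicator_def)
  also have "\<dots> = (\<integral>\<^sup>+z. (case z of (s,t) \<Rightarrow> ennreal (std_normal_density s) * indicator {0<..<1} t) * g z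
      \<partial>(lborel \<Otimes>\<^sub>M lborel))"
    by (rule distributed_nn_integral[OF J, symmetric]) measurable
  also have "\<dots> = (\<integral>\<^sup>+s. \<integral>\<^sup>+t. ennreal (std_normal_density s) * indicator {0<..<1} t * g (s,t) \<partial>lborel \<partial>lborel)"
    by (subst lborel.nn_integral_fst[symmetric]) auto
  also have "\<dots> = (\<integral>\<^sup>+s. ennreal (k s * max 0 (std_normal_density s - std_normal_density (s + h))) \<partial>lborel)"
  proof (rule nn_integral_cong)
    fix s :: real
    have pos: "std_normal_density s > 0" "std_normal_density (s + h) > 0"
      by (simp_all add: normal_density_pos)
    then have \<rho>: "?\<rho> s > 0" by simp
    have "(\<integral>\<^sup>+t. ennreal (std_normal_density s) * indicator {0<..<1} t * g (s,t) \<partial>lborel)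
        = (\<integral>\<^sup>+t. ennreal (std_normal_density s * k s) * indicator {?\<rho> s<..<1} t \<partial>lborel)"
      using \<rho> k by (intro nn_integral_cong) (auto simp: g_def ennreal_mult split: split_indicator)
    also have "\<dots> = ennreal (std_normal_density s * k s) * emeasure lborel {?\<rho> s<..<1}"
      by (rule nn_integral_cmult_indicator) simp
    also have "emeasure lborel {?\<rho> s<..<1} = ennreal (max 0 (1 - ?\<rho> s))"
      by (simp add: emeasure_lborel_Ioo max_def)
    also have "ennreal (std_normal_density s * k s) * \<dots>
        = ennreal (std_normal_density s * k s * max 0 (1 - ?\<rho> s))"
      using k by (simp add: ennreal_mult)
    also have "std_normal_density s * k s * max 0 (1 - ?\<rho> s)
        = k s * max 0 (std_normal_density s - std_normal_density (s + h))"
      using pos by (simp add: max_def field_simps)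
    finally show "(\<integral>\<^sup>+t. ennreal (std_normal_density s) * indicator {0<..<1} t * g (s,t) \<partial>lborel)
        = ennreal (k s * max 0 (std_normal_density s - std_normal_density (s + h)))" .
  qed
  finally show ?thesis .
qed

text \<open>
  Events about \<open>e \<bullet> \<xi>\<close> are events about \<open>\<xi>\<close>; in contrast to \<open>\<xi>\<close>, the projection has the
  same type as \<open>u\<close>.
\<close>

lemma indep_var_of_noise:
  fixes \<xi> :: "'w \<Rightarrow> 'a::euclidean_space"
  assumes N: "coupling_noise M \<xi> u"
  shows "prob_space.indep_var M borel (\<lambda>\<omega>. e \<bullet> \<xi> \<omega>) borel u"
proof -
  interpret prob_space M using N by (simp add: coupling_noise_def)
  have [measurable]: "\<xi> \<in> measurable M borel" "u \<in> measurable M borel"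
    using N by (auto simp: coupling_noise_def dest!: distributed_measurable)
  have ind: "indep_set {\<xi> -` A \<inter> space M |A. A \<in> sets borel} {u -` B \<inter> space M |B. B \<in> sets borel}"
    using N by (simp add: coupling_noise_def)
  have S: "sigma_sets (space M) {X -` A \<inter> space M |A. A \<in> sets borel} = {X -` A \<inter> space M |A. A \<in> sets borel}"
    for X :: "'w \<Rightarrow> real"
    using sigma_sets_vimage_commute[of X "space M" UNIV "sets borel", symmetric]
      sets.sigma_sets_eq[of "borel :: real measure"]
    by (simp only: space_borel UNIV_I Pi_UNIV)
  have sub: "{(\<lambda>\<omega>. e \<bullet> \<xi> \<omega>) -` A \<inter> space M |A. A \<in> sets borel} \<subseteq> {\<xi> -` A \<inter> space M |A. A \<in> sets borel}"
  proof safe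
    fix A :: "real set" assume "A \<in> sets borel"
    then have "(\<bullet>) e -` A \<in> sets borel" by (rule measurable_sets_borel[rotated]) simp
    then show "\<exists>B. (\<lambda>\<omega>. e \<bullet> \<xi> \<omega>) -` A \<inter> space M = \<xi> -` B \<inter> space M \<and> B \<in> sets borel"
      by (intro exI[of _ "(\<bullet>) e -` A"]) auto
  qed
  have "indep_set {(\<lambda>\<omega>. e \<bullet> \<xi> \<omega>) -` A \<inter> space M |A. A \<in> sets borel} {u -` B \<inter> space M |B. B \<in> sets borel}"
    by (rule indep_setI[OF order_trans[OF sub indep_setD_ev1[OF ind]] indep_setD_ev2[OF ind]])
       (rule indep_setD[OF ind subsetD[OF sub]])
  then show ?thesis unfolding indep_var_eq S by (intro conjI) measurable
qed

section \<open>The concave distance profile\<close>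

text \<open>
  The function \<open>f\<close> in closed form: it saturates exponentially up to \<open>R\<^sub>1\<close> and continues with its
  tangent there.
\<close>

definition profile :: "real \<Rightarrow> real \<Rightarrow> real \<Rightarrow> real" where
  "profile T R\<^sub>1 r = T * (1 - exp (- (min r R\<^sub>1 / T))) + (max r R\<^sub>1 - R\<^sub>1) * exp (- (R\<^sub>1 / T))"

lemma measurable_profile [measurable]: "profile T R\<^sub>1 \<in> borel_measurable borel"
  unfolding profile_def by measurable

lemma profile_0 [simp]: "0 \<le> R\<^sub>1 \<Longrightarrow> profile T R\<^sub>1 0 = 0"
  by (simp add: profile_def)

lemma exp_tangent:
  fixes T r s :: real
  assumes "T > 0"
  shows "T * (exp (- (r / T)) - exp (- (s / T))) \<le> exp (- (r / T)) * (s - r)"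
proof -
  have "1 + (r - s) / T \<le> exp ((r - s) / T)" by (rule exp_ge_add_one_self)
  then have "exp (- (r / T)) * (1 + (r - s) / T) \<le> exp (- (r / T)) * exp ((r - s) / T)"
    by (intro mult_left_mono) auto
  also have "\<dots> = exp (- (s / T))" by (simp add: exp_add[symmetric] diff_divide_distrib)
  finally have "T * (exp (- (r / T)) * (1 + (r - s) / T)) \<le> T * exp (- (s / T))"
    using assms by (intro mult_left_mono) auto
  moreover have "T * (exp (- (r / T)) * (1 + (r - s) / T)) = T * exp (- (r / T)) + exp (- (r / T)) * (r - s)"
    using assms by (simp add: distrib_left)
  ultimately show ?thesis by (simp add: algebra_simps)
qed

lemma profile_eq_integral:
  assumes T: "T > 0" and R: "0 \<le> R\<^sub>1" and r: "0 \<le> r"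
  shows "integral {0..r} (\<lambda>s. exp (- (1 / T) * min s R\<^sub>1)) = profile T R\<^sub>1 r"
proof -
  let ?g = "\<lambda>s. exp (- (1 / T) * min s R\<^sub>1)"
  have low: "(?g has_integral T * (1 - exp (- (r / T)))) {0..r}" if "0 \<le> r" "r \<le> R\<^sub>1" for r
  proof -
    have "((\<lambda>s. exp (- (1 / T) * s)) has_integral - T * exp (- (1/T) * r) - (- T * exp (- (1/T) * 0))) {0..r}"
      using T that by (intro fundamental_theorem_of_calculus)
        (auto intro!: derivative_eq_intros simp flip: has_real_derivative_iff_has_vector_derivative)
    then have "((\<lambda>s. exp (- (1 / T) * s)) has_integral T * (1 - exp (- (r / T)))) {0..r}"
      by (simp add: algebra_simps)
    then show ?thesis by (rule has_integral_eq[rotated]) (use that in auto)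
  qed
  show ?thesis
  proof (cases "r \<le> R\<^sub>1")
    case True
    then show ?thesis using low[OF r] by (simp add: profile_def integral_unique max_def)
  next
    case False
    have "((\<lambda>s. exp (- (R\<^sub>1 / T))) has_integral (r - R\<^sub>1) * exp (- (R\<^sub>1 / T))) {R\<^sub>1..r}"
      using False has_integral_const_real[of "exp (- (R\<^sub>1 / T))" R\<^sub>1 r] by simp
    then have "(?g has_integral (r - R\<^sub>1) * exp (- (R\<^sub>1 / T))) {R\<^sub>1..r}"
      by (rule has_integral_eq[rotated]) auto
    from has_integral_combine[OF R _ low[OF R order_refl] this] False
    show ?thesis by (simp add: profile_def integral_unique min_def max_def)
  qed
qed

text \<open>
  \<open>exp (- min r R\<^sub>1 / T)\<close> is the slope at \<open>r\<close>, so this is the tangent inequality of a concave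
  function. Each of the four positions of \<open>r\<close> and \<open>s\<close> relative to \<open>R\<^sub>1\<close> follows from the
  tangent inequality of the exponential.
\<close>

lemma profile_concave:
  assumes T: "T > 0"
  shows "profile T R\<^sub>1 s \<le> profile T R\<^sub>1 r + exp (- (min r R\<^sub>1 / T)) * (s - r)"
proof -
  have 1: "exp (- (R\<^sub>1 / T)) * (s - R\<^sub>1) \<le> exp (- (r / T)) * (s - R\<^sub>1)" if "r \<le> R\<^sub>1" "R\<^sub>1 \<le> s"
    using that T by (intro mult_right_mono) (auto simp: divide_right_mono)
  show ?thesis
    using exp_tangent[OF T, of r s] exp_tangent[OF T, of r R\<^sub>1] exp_tangent[OF T, of R\<^sub>1 s] 1
    by (cases "r \<le> R\<^sub>1"; cases "s \<le> R\<^sub>1") (auto simp: profile_def min_def max_def algebra_simps)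
qed

text \<open>
  From \<open>r\<close> to \<open>R\<^sub>1\<close> the slope is \<open>exp (- s / T)\<close>, whose integral over all \<open>s \<ge> r\<close> is
  \<open>T exp (- r / T)\<close>.
\<close>

lemma profile_increment_le:
  assumes T: "T > 0" and r: "r \<le> R\<^sub>1"
  shows "profile T R\<^sub>1 s \<le> profile T R\<^sub>1 r + T * exp (- (r / T)) + exp (- (R\<^sub>1 / T)) * max 0 (s - R\<^sub>1)"
proof -
  have "T * exp (- (min s R\<^sub>1 / T)) \<ge> 0" using T by (intro mult_nonneg_nonneg) auto
  moreover have "profile T R\<^sub>1 r = T * (1 - exp (- (r / T)))" using r by (simp add: profile_def)
  moreover have "max s R\<^sub>1 - R\<^sub>1 = max 0 (s - R\<^sub>1)" by (simp add: max_def)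
  ultimately show ?thesis by (simp add: profile_def algebra_simps)
qed

lemma profile_le: "T > 0 \<Longrightarrow> 0 \<le> R\<^sub>1 \<Longrightarrow> profile T R\<^sub>1 r \<le> r"
  using profile_concave[of T R\<^sub>1 r 0] by simp

lemma profile_nonneg:
  assumes T: "T > 0" and R: "0 \<le> R\<^sub>1" and r: "0 \<le> r"
  shows "0 \<le> profile T R\<^sub>1 r"
proof -
  have "0 \<le> exp (- (min r R\<^sub>1 / T)) * r" using r by simp
  moreover have "0 \<le> profile T R\<^sub>1 r + exp (- (min r R\<^sub>1 / T)) * (0 - r)"
    using profile_concave[OF T, of R\<^sub>1 0 r] profile_0[OF R] by metis
  ultimately show ?thesis by simp
qed

lemma x_exp_le: "x * exp (- x) \<le> exp (- 1)" for x :: real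
proof -
  have "x \<le> exp (x - 1)" using exp_ge_add_one_self[of "x - 1"] by simp
  then have "x * exp (- x) \<le> exp (x - 1) * exp (- x)" by (intro mult_right_mono) auto
  then show ?thesis by (simp add: exp_add[symmetric])
qed

lemma x_exp_antimono:
  fixes x y :: real assumes "1 \<le> x" "x \<le> y"
  shows "y * exp (- y) \<le> x * exp (- x)"
proof -
  have "y \<le> x * (1 + (y - x))" using mult_nonneg_nonneg[of "x - 1" "y - x"] assms by (simp add: algebra_simps)
  also have "\<dots> \<le> x * exp (y - x)" using assms by (intro mult_left_mono exp_ge_add_one_self) auto
  finally have "y * exp (- y) \<le> x * exp (y - x) * exp (- y)" by (intro mult_right_mono) auto
  then show ?thesis by (simp add: mult.assoc exp_add[symmetric])
qed

text \<open>
  The quotient of \<open>r f'(r)\<close> and \<open>f(r)\<close> is smallest at \<open>r = R\<^sub>1\<close>, with value \<open>y / (exp y - 1)\<close>;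
  the slightly smaller \<open>y exp (- y)\<close> is enough for the rate and easier to handle.
\<close>

lemma profile_slope_ratio:
  assumes T: "T > 0" and r: "0 \<le> r" and R: "0 \<le> R\<^sub>1"
  defines "y \<equiv> R\<^sub>1 / T"
  shows "y * exp (- y) * profile T R\<^sub>1 r \<le> r * exp (- (min r R\<^sub>1 / T))"
proof -
  have y: "y \<ge> 0" "y * T = R\<^sub>1" using T R by (simp_all add: y_def)
  have ye: "y * exp (- y) \<le> exp (- 1)" by (rule x_exp_le)
  have ye0: "0 \<le> y * exp (- y)" using y by simp
  show ?thesis
  proof (cases "r \<le> R\<^sub>1")
    case True
    define x where "x = r / T"
    have x: "0 \<le> x" "x \<le> y" "r = T * x" using T r True by (simp_all add: x_def y_def divide_right_mono)
    have "y * exp (- y) * (1 - exp (- x)) \<le> x * exp (- x)"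
    proof (cases "1 \<le> x")
      case True
      have "y * exp (- y) * (1 - exp (- x)) \<le> y * exp (- y) * 1" by (intro mult_left_mono ye0) simp
      also have "\<dots> \<le> x * exp (- x)" using x_exp_antimono[OF True x(2)] by simp
      finally show ?thesis .
    next
      case False
      have "1 - exp (- x) \<le> x" using exp_ge_add_one_self[of "- x"] by simp
      moreover have "y * exp (- y) \<le> exp (- x)" using ye False by (smt (verit) exp_less_cancel_iff)
      ultimately have "y * exp (- y) * (1 - exp (- x)) \<le> exp (- x) * x"
        using x(1) by (intro mult_mono) auto
      then show ?thesis by (simp add: mult.commute)
    qed
    then have "T * (y * exp (- y) * (1 - exp (- x))) \<le> T * (x * exp (- x))"
      using T by (intro mult_left_mono) auto
    moreover have "profile T R\<^sub>1 r = T * (1 - exp (- x))" using True by (simp add: profile_def x_def)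
    moreover have "r * exp (- (min r R\<^sub>1 / T)) = T * (x * exp (- x))" using True T by (simp add: x_def)
    ultimately show ?thesis by (simp only: ac_simps)
  next
    case False
    have "y * (T * (1 - exp (- y))) \<le> R\<^sub>1"
    proof -
      have "R\<^sub>1 * (1 - exp (- y)) \<le> R\<^sub>1 * 1" using R by (intro mult_left_mono) auto
      then show ?thesis using y(2) by (simp add: mult.assoc[symmetric])
    qed
    moreover have "y * ((r - R\<^sub>1) * exp (- y)) \<le> r - R\<^sub>1"
    proof -
      have "y * exp (- y) * (r - R\<^sub>1) \<le> 1 * (r - R\<^sub>1)"
        using ye False by (intro mult_right_mono) (auto intro: order_trans[OF ye])
      then show ?thesis by (simp add: algebra_simps)
    qed
    moreover have P: "profile T R\<^sub>1 r = T * (1 - exp (- y)) + (r - R\<^sub>1) * exp (- y)"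
      using False by (simp add: profile_def y_def)
    ultimately have "y * profile T R\<^sub>1 r \<le> r" by (simp add: distrib_left)
    then have "exp (- y) * (y * profile T R\<^sub>1 r) \<le> exp (- y) * r" by (intro mult_left_mono) auto
    then show ?thesis using False by (simp add: y_def algebra_simps)
  qed
qed

section \<open>Gradient and Hessian of the potential\<close>

lemma GDERIV_gradient:
  fixes f :: "'a::euclidean_space \<Rightarrow> real"
  assumes "f differentiable (at x)"
  shows "GDERIV f x :> (\<Sum>b\<in>Basis. frechet_derivative f (at x) b *\<^sub>R b)"
    and "gradient f x = (\<Sum>b\<in>Basis. frechet_derivative f (at x) b *\<^sub>R b)"
proof -
  let ?D = "frechet_derivative f (at x)" and ?g = "\<Sum>b\<in>Basis. frechet_derivative f (at x) b *\<^sub>R b"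
  have D: "(f has_derivative ?D) (at x)" using assms by (rule frechet_derivative_works[THEN iffD1])
  then interpret linear ?D by (rule has_derivative_linear)
  have "?D h = h \<bullet> ?g" for h
  proof -
    have "?D h = ?D (\<Sum>b\<in>Basis. (h \<bullet> b) *\<^sub>R b)" by (simp add: euclidean_representation)
    also have "\<dots> = h \<bullet> ?g" by (simp add: sum scale inner_sum_right mult.commute)
    finally show ?thesis .
  qed
  then have "?D = (\<lambda>h. h \<bullet> ?g)" by (rule ext)
  with D show G: "GDERIV f x :> ?g" unfolding gderiv_def by metis
  show "gradient f x = ?g" unfolding gradient_def
  proof (rule the_equality)
    show "GDERIV f x :> ?g" by (rule G)
    fix g assume "GDERIV f x :> g"
    with G have "(\<lambda>h. h \<bullet> ?g) = (\<lambda>h. h \<bullet> g)" unfolding gderiv_def by (rule has_derivative_unique)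
    then have "h \<bullet> ?g = h \<bullet> g" for h by (rule fun_cong)
    then have "\<forall>h. h \<bullet> ?g = h \<bullet> g" by (rule allI)
    then have "?g = g" by (rule vector_eq_ldot[THEN iffD1])
    then show "g = ?g" by (rule sym)
  qed
qed

lemma inner_gradient:
  fixes f :: "'a::euclidean_space \<Rightarrow> real"
  assumes "f differentiable (at x)"
  shows "gradient f x \<bullet> v = frechet_derivative f (at x) v"
proof -
  have "(f has_derivative (\<lambda>h. h \<bullet> gradient f x)) (at x)"
    using GDERIV_gradient(1)[OF assms] unfolding GDERIV_gradient(2)[OF assms] gderiv_def .
  then have "frechet_derivative f (at x) = (\<lambda>h. h \<bullet> gradient f x)"
    by (rule frechet_derivative_at[symmetric])
  then show ?thesis by (simp add: inner_commute)
qed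

lemma has_derivative_gradient:
  fixes U :: "'a::euclidean_space \<Rightarrow> real"
  assumes "C_k 2 U"
  shows "(gradient U has_derivative hessian U x) (at x)"
proof -
  have C: "U differentiable (at y)" "(\<lambda>y. frechet_derivative U (at y) v) differentiable (at y)" for y v
    using assms by (simp_all add: numeral_2_eq_2)
  have "gradient U = (\<lambda>y. \<Sum>b\<in>Basis. frechet_derivative U (at y) b *\<^sub>R b)"
    using GDERIV_gradient(2)[OF C(1)] by auto
  then have "gradient U differentiable (at x)"
    by (auto intro!: differentiable_sum differentiable_scaleR C)
  then show ?thesis unfolding hessian_def by (rule frechet_derivative_works[THEN iffD1])
qed

lemma iter_deriv_2_eq_hessian:
  fixes U :: "'a::euclidean_space \<Rightarrow> real"
  assumes "C_k 2 U"
  shows "iter_deriv U [v, w] x = hessian U x v \<bullet> w"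
proof -
  have "U differentiable (at y)" for y using assms by (simp add: numeral_2_eq_2)
  then have "(\<lambda>y. frechet_derivative U (at y) w) = (\<lambda>y. gradient U y \<bullet> w)"
    by (simp add: inner_gradient)
  moreover have "((\<lambda>y. gradient U y \<bullet> w) has_derivative (\<lambda>h. hessian U x h \<bullet> w)) (at x)"
    by (rule has_derivative_inner_left[OF has_derivative_gradient[OF assms]])
  then have "frechet_derivative (\<lambda>y. gradient U y \<bullet> w) (at x) = (\<lambda>h. hessian U x h \<bullet> w)"
    by (rule frechet_derivative_at[symmetric])
  ultimately show ?thesis by simp
qed

lemma C_k_antimono: "C_k (Suc k) f \<Longrightarrow> C_k k f"
proof (induction k arbitrary: f)
  case 0
  then show ?case by (simp add: differentiable_imp_continuous_on differentiable_at_imp_differentiable_on)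
next
  case (Suc k)
  then show ?case by (metis C_k.simps(2))
qed

text \<open>
  \<open>L\<close> is a supremum of operator norms, which bounds them only because they are bounded at all;
  this is what the bound on the second derivative provides.
\<close>

lemma gradient_Lipschitz:
  fixes U :: "'a::euclidean_space \<Rightarrow> real"
  assumes C: "C_k 4 U" and A2: "assm_A2 U L"
  shows "norm (gradient U x - gradient U y) \<le> L * norm (x - y)"
proof -
  have "C_k (Suc (Suc 2)) U" using C by simp
  then have C2: "C_k 2 U" by (rule C_k_antimono[OF C_k_antimono])
  from A2 obtain B where B: "\<And>x vs. length vs = 2 \<Longrightarrow> \<bar>iter_deriv U vs x\<bar> \<le> B * (\<Prod>v\<leftarrow>vs. norm v)"
    unfolding assm_A2_def bounded_kth_deriv_def by blast
  have "norm (hessian U x v) \<le> B * norm v" for x v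
  proof (cases "hessian U x v = 0")
    case True
    obtain b :: 'a where b: "b \<in> Basis" using SOME_Basis by blast
    have "0 \<le> B" using B[of "[b, b]" x] b by (simp add: order_trans[OF abs_ge_zero])
    with True show ?thesis by simp
  next
    case False
    have "norm (hessian U x v) * norm (hessian U x v) \<le> B * norm v * norm (hessian U x v)"
      using B[of "[v, hessian U x v]" x] iter_deriv_2_eq_hessian[OF C2, of v "hessian U x v" x]
      by (simp add: norm_eq_sqrt_inner)
    with False show ?thesis by simp
  qed
  then have "onorm (hessian U x) \<le> B" for x by (intro onorm_le)
  then have "bdd_above (range (\<lambda>x. onorm (hessian U x)))" by (intro bdd_aboveI) auto
  then have L: "onorm (hessian U x) \<le> L" for x
    using A2 unfolding assm_A2_def by (auto intro: cSUP_upper)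
  show ?thesis
    by (rule differentiable_bound[of UNIV "gradient U" "hessian U"])
       (auto intro: has_derivative_at_withinI has_derivative_gradient[OF C2] L)
qed

text \<open>
  The two inequalities compete on any pair of points at distance at least \<open>R\<close>. The consequence is
  used to make \<open>L\<close> positive and to turn the upper bounds on \<open>L T\<^sup>2\<close> and \<open>L T R\<close> into bounds on
  \<open>K T\<^sup>2\<close> and \<open>K T R\<close>.
\<close>

lemma convexity_le_Lipschitz:
  fixes U :: "'a::euclidean_space \<Rightarrow> real"
  assumes A3: "assm_A3 U K R"
    and Lip: "\<And>x y. norm (gradient U x - gradient U y) \<le> L * norm (x - y)"
  shows "K \<le> L"
proof -
  obtain b :: 'a where b: "b \<in> Basis" using SOME_Basis by blast
  \<comment> \<open>The length \<open>R + 1\<close> is positive even if \<open>R = 0\<close>.\<close>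
  define z where "z = (R + 1) *\<^sub>R b"
  have z: "norm z = R + 1" "0 < norm z" using A3 b by (simp_all add: z_def assm_A3_def)
  have "K * (norm z)\<^sup>2 \<le> z \<bullet> (gradient U z - gradient U 0)"
    using A3 z unfolding assm_A3_def by (metis diff_zero less_add_one less_imp_le)
  also have "\<dots> \<le> norm z * norm (gradient U z - gradient U 0)" by (rule norm_cauchy_schwarz)
  also have "\<dots> \<le> norm z * (L * norm z)" using Lip[of z 0] by (intro mult_left_mono) auto
  finally have "K * (norm z)\<^sup>2 \<le> L * (norm z)\<^sup>2" by (simp add: power2_eq_square mult.left_commute)
  then show ?thesis using z(2) by simp
qed

section \<open>Differences of two Hamiltonian trajectories\<close>

text \<open>
  The mean value inequality with the closed interval as domain, as it is needed for flows that are
  defined for nonnegative times only.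
\<close>

lemma norm_increment_le:
  fixes g :: "real \<Rightarrow> 'a::euclidean_space"
  assumes t: "0 \<le> t"
    and g: "\<And>s. 0 \<le> s \<Longrightarrow> s \<le> t \<Longrightarrow> (g has_vector_derivative g' s) (at s within {0..t})"
    and h: "\<And>s. 0 \<le> s \<Longrightarrow> s \<le> t \<Longrightarrow> (h has_vector_derivative h' s) (at s within {0..t})"
    and le: "\<And>s. 0 \<le> s \<Longrightarrow> s \<le> t \<Longrightarrow> norm (g' s) \<le> (h' s :: real)"
  shows "norm (g t - g 0) \<le> h t - h 0"
proof (cases "t = 0")
  case False
  then have t0: "0 < t" using t by simp
  have at: "at s within {0..t} = at s" if "0 < s" "s < t" for s
    using that by (simp add: at_within_Icc_at)
  show ?thesis
  proof (rule differentiable_bound_general[OF t0])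
    show "continuous_on {0..t} g" "continuous_on {0..t} h"
      using g h by (auto intro!: continuous_on_vector_derivative)
    show "(g has_vector_derivative g' s) (at s)" "(h has_vector_derivative h' s) (at s)" "norm (g' s) \<le> h' s"
      if "0 < s" "s < t" for s
      using g[of s] h[of s] le[of s] at[OF that] that by auto
  qed
qed simp

lemma has_vector_derivative_nonneg_imp_le:
  fixes h :: "real \<Rightarrow> real"
  assumes t: "0 \<le> t"
    and h: "\<And>s. 0 \<le> s \<Longrightarrow> s \<le> t \<Longrightarrow> (h has_vector_derivative h' s) (at s within {0..t})"
    and nonneg: "\<And>s. 0 \<le> s \<Longrightarrow> s \<le> t \<Longrightarrow> 0 \<le> h' s"
  shows "h 0 \<le> h t"
  using norm_increment_le[of t "\<lambda>_. 0 :: real" "\<lambda>_. 0" h h'] t h nonneg by simp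

text \<open>
  The difference of two trajectories: position difference \<open>z\<close>, velocity difference \<open>w\<close> and
  difference \<open>F\<close> of the gradients, which is assumed to satisfy the Lipschitz bound along the pair.
\<close>

locale flow_difference =
  fixes z w F :: "real \<Rightarrow> 'a::euclidean_space" and T L :: real
  assumes z: "\<And>t. 0 \<le> t \<Longrightarrow> t \<le> T \<Longrightarrow> (z has_vector_derivative w t) (at t within {0..T})"
    and w: "\<And>t. 0 \<le> t \<Longrightarrow> t \<le> T \<Longrightarrow> (w has_vector_derivative - F t) (at t within {0..T})"
    and F: "\<And>t. 0 \<le> t \<Longrightarrow> t \<le> T \<Longrightarrow> norm (F t) \<le> L * norm (z t)"
    and T: "0 \<le> T" and L: "0 \<le> L" and LT: "L * T\<^sup>2 \<le> 1/4"
begin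

lemma z_within: "0 \<le> s \<Longrightarrow> s \<le> t \<Longrightarrow> t \<le> T \<Longrightarrow> (z has_vector_derivative w s) (at s within {0..t})"
  by (rule has_vector_derivative_within_subset[OF z]) auto

lemma w_within: "0 \<le> s \<Longrightarrow> s \<le> t \<Longrightarrow> t \<le> T \<Longrightarrow> (w has_vector_derivative - F s) (at s within {0..t})"
  by (rule has_vector_derivative_within_subset[OF w]) auto

lemma velocity_drift:
  assumes B: "\<And>s. 0 \<le> s \<Longrightarrow> s \<le> T \<Longrightarrow> norm (z s) \<le> B" and t: "0 \<le> t" "t \<le> T"
  shows "norm (w t - w 0) \<le> L * B * t"
proof -
  have "norm (w t - w 0) \<le> L * B * t - L * B * 0"
  proof (rule norm_increment_le[OF t(1)])
    fix s assume s: "0 \<le> s" "s \<le> t"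
    show "(w has_vector_derivative - F s) (at s within {0..t})" using w_within s t by blast
    show "((\<lambda>t. L * B * t) has_vector_derivative L * B) (at s within {0..t})"
      by (auto intro!: derivative_eq_intros simp flip: has_real_derivative_iff_has_vector_derivative)
    have "L * norm (z s) \<le> L * B" using B s t L by (intro mult_left_mono) auto
    then show "norm (- F s) \<le> L * B" using F[of s] s t by simp
  qed
  then show ?thesis by simp
qed

lemma position_drift:
  assumes B: "\<And>s. 0 \<le> s \<Longrightarrow> s \<le> T \<Longrightarrow> norm (z s) \<le> B" and t: "0 \<le> t" "t \<le> T"
  shows "norm (z t - z 0 - t *\<^sub>R w 0) \<le> L * B * t\<^sup>2 / 2"
proof -
  let ?g = "\<lambda>t. z t - t *\<^sub>R w 0"
  have "norm (?g t - ?g 0) \<le> L * B * t\<^sup>2 / 2 - L * B * 0\<^sup>2 / 2"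
  proof (rule norm_increment_le[OF t(1)])
    fix s assume s: "0 \<le> s" "s \<le> t"
    show "(?g has_vector_derivative w s - w 0) (at s within {0..t})"
      using z_within[of s t] s t by (auto intro!: derivative_eq_intros)
    show "((\<lambda>t. L * B * t\<^sup>2 / 2) has_vector_derivative L * B * s) (at s within {0..t})"
      by (auto intro!: derivative_eq_intros simp flip: has_real_derivative_iff_has_vector_derivative)
    show "norm (w s - w 0) \<le> L * B * s" using velocity_drift[OF B] s t by auto
  qed
  then show ?thesis by (simp add: algebra_simps)
qed

lemma norm_interpolation: "0 \<le> t \<Longrightarrow> t \<le> T \<Longrightarrow> norm (z 0 + t *\<^sub>R w 0) \<le> max (norm (z 0)) (norm (z 0 + T *\<^sub>R w 0))"
proof (cases "T = 0")
  case False
  assume t: "0 \<le> t" "t \<le> T"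
  define \<theta> where "\<theta> = t / T"
  have \<theta>: "0 \<le> \<theta>" "\<theta> \<le> 1" "t = \<theta> * T" using t T False by (simp_all add: \<theta>_def)
  let ?m = "max (norm (z 0)) (norm (z 0 + T *\<^sub>R w 0))"
  have "z 0 + t *\<^sub>R w 0 = (1 - \<theta>) *\<^sub>R z 0 + \<theta> *\<^sub>R (z 0 + T *\<^sub>R w 0)"
    by (simp add: \<theta>(3) algebra_simps)
  also have "norm \<dots> \<le> norm ((1 - \<theta>) *\<^sub>R z 0) + norm (\<theta> *\<^sub>R (z 0 + T *\<^sub>R w 0))" by (rule norm_triangle_ineq)
  also have "\<dots> \<le> (1 - \<theta>) * ?m + \<theta> * ?m"
    using \<theta> by (simp, intro add_mono mult_left_mono) auto
  also have "\<dots> = ?m" by (simp add: algebra_simps)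
  finally show ?thesis .
qed simp

text \<open>
  The drift away from free flight is at most \<open>L T\<^sup>2 / 2 \<le> 1/8\<close> times the largest value \<open>B\<close> of \<open>|z|\<close>,
  and free flight stays below \<open>m\<close> by convexity of the norm. Hence \<open>B \<le> m + B/8\<close>, and \<open>B \<le> 8/7 m\<close>
  is fed back into the drift.
\<close>

lemma norm_bounds:
  defines "m \<equiv> max (norm (z 0)) (norm (z 0 + T *\<^sub>R w 0))"
  assumes t: "0 \<le> t" "t \<le> T"
  shows "norm (z t) \<le> 8/7 * m"
    and "norm (z t - z 0 - t *\<^sub>R w 0) \<le> 4/7 * (L * T\<^sup>2) * m"
proof -
  have "continuous_on {0..T} z" using z by (auto intro!: continuous_on_vector_derivative)
  then have "continuous_on {0..T} (\<lambda>t. norm (z t))" by (rule continuous_on_norm)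
  moreover have "{0..T} \<noteq> {}" using T by simp
  ultimately obtain \<tau> where \<tau>: "0 \<le> \<tau>" "\<tau> \<le> T" "\<And>s. 0 \<le> s \<Longrightarrow> s \<le> T \<Longrightarrow> norm (z s) \<le> norm (z \<tau>)"
    using continuous_attains_sup[OF compact_Icc] by (metis atLeastAtMost_iff)
  let ?B = "norm (z \<tau>)"
  have drift: "norm (z s - z 0 - s *\<^sub>R w 0) \<le> L * T\<^sup>2 / 2 * ?B" if "0 \<le> s" "s \<le> T" for s
  proof -
    have "norm (z s - z 0 - s *\<^sub>R w 0) \<le> L * ?B * s\<^sup>2 / 2" by (rule position_drift[OF \<tau>(3) that])
    also have "\<dots> \<le> L * ?B * T\<^sup>2 / 2"
      using that L by (intro divide_right_mono mult_left_mono power_mono) auto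
    finally show ?thesis by (simp add: algebra_simps)
  qed
  have "?B = norm ((z 0 + \<tau> *\<^sub>R w 0) + (z \<tau> - z 0 - \<tau> *\<^sub>R w 0))" by simp
  also have "\<dots> \<le> m + L * T\<^sup>2 / 2 * ?B"
    using norm_interpolation[OF \<tau>(1,2)] drift[OF \<tau>(1,2)] by (intro norm_triangle_le) (simp add: m_def)
  also have "L * T\<^sup>2 / 2 * ?B \<le> 1/8 * ?B" using LT by (intro mult_right_mono) auto
  finally have B: "?B \<le> 8/7 * m" by simp
  then show "norm (z t) \<le> 8/7 * m" using \<tau>(3)[OF t] by simp
  have "L * T\<^sup>2 / 2 * ?B \<le> L * T\<^sup>2 / 2 * (8/7 * m)" using L B by (intro mult_left_mono) auto
  also have "\<dots> = 4/7 * (L * T\<^sup>2) * m" by simp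
  finally show "norm (z t - z 0 - t *\<^sub>R w 0) \<le> 4/7 * (L * T\<^sup>2) * m" using drift[OF t] by linarith
qed

text \<open>
  Here \<open>(|z|\<^sup>2)'' = 2 |w|\<^sup>2 - 2 z \<bullet> F\<close>. The bounds \<open>|w(t)| \<le> 8/7 L t |z(0)|\<close> and
  \<open>|z(t)| \<ge> 6/7 |z(0)|\<close> make the right side at most
  \<open>(128/49 L\<^sup>2 t\<^sup>2 - 72/49 K) |z(0)|\<^sup>2\<close>; after two integrations, and with \<open>L\<^sup>2 T\<^sup>2 \<le> K\<close>, the factor of
  \<open>K T\<^sup>2 |z(0)|\<^sup>2\<close> is at most \<open>32/147 - 36/49 = - 76/147 < - 1/2\<close>.
\<close>

lemma contraction:
  assumes w0: "w 0 = 0" and K: "0 \<le> K" and KT: "K * T\<^sup>2 \<le> 4" and LK: "L * T\<^sup>2 \<le> K / L"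
    and mono: "\<And>t. 0 \<le> t \<Longrightarrow> t \<le> T \<Longrightarrow> 6/7 * norm (z 0) \<le> norm (z t) \<Longrightarrow> K * (norm (z t))\<^sup>2 \<le> z t \<bullet> F t"
  shows "norm (z T) \<le> (1 - K * T\<^sup>2 / 4) * norm (z 0)"
proof -
  define N where "N = (norm (z 0))\<^sup>2"
  have N: "N \<ge> 0" by (simp add: N_def)
  have zB: "norm (z t) \<le> 8/7 * norm (z 0)" if "0 \<le> t" "t \<le> T" for t
    using norm_bounds(1)[OF that] by (simp add: w0)
  have zl: "6/7 * norm (z 0) \<le> norm (z t)" if "0 \<le> t" "t \<le> T" for t
  proof -
    have "norm (z t - z 0) \<le> 4/7 * (L * T\<^sup>2) * norm (z 0)" using norm_bounds(2)[OF that] by (simp add: w0)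
    also have "\<dots> \<le> 4/7 * (1/4) * norm (z 0)" using LT by (intro mult_right_mono mult_left_mono) auto
    finally have "norm (z t - z 0) \<le> 1/7 * norm (z 0)" by simp
    then show ?thesis using norm_triangle_ineq2[of "z 0" "z t"] by (simp add: norm_minus_commute)
  qed
  have L2: "L * L * T\<^sup>2 \<le> K"
    using LK L K by (cases "L = 0") (auto simp: field_simps)
  have ww: "w t \<bullet> w t \<le> 64/49 * L\<^sup>2 * N * t\<^sup>2" if "0 \<le> t" "t \<le> T" for t
  proof -
    have "norm (w t) \<le> L * (8/7 * norm (z 0)) * t" using velocity_drift[OF zB that] by (simp add: w0)
    then have "(norm (w t))\<^sup>2 \<le> (L * (8/7 * norm (z 0)) * t)\<^sup>2" by (intro power_mono) auto
    then show ?thesis by (simp add: power_mult_distrib N_def power_divide power2_norm_eq_inner)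
  qed
  have zF: "36/49 * K * N \<le> z t \<bullet> F t" if "0 \<le> t" "t \<le> T" for t
  proof -
    have "(6/7 * norm (z 0))\<^sup>2 \<le> (norm (z t))\<^sup>2" using zl[OF that] by (intro power_mono) auto
    then have "K * (36/49 * N) \<le> K * (norm (z t))\<^sup>2"
      using K by (intro mult_left_mono) (simp_all add: power_mult_distrib N_def power_divide)
    with mono[OF that zl[OF that]] show ?thesis by simp
  qed
  have zw: "z t \<bullet> w t \<le> 64/147 * L\<^sup>2 * N * t ^ 3 - 36/49 * K * N * t" if t: "0 \<le> t" "t \<le> T" for t
  proof -
    let ?h = "\<lambda>t. 64/147 * L\<^sup>2 * N * t ^ 3 - 36/49 * K * N * t - z t \<bullet> w t"
    have "?h 0 \<le> ?h t"
    proof (rule has_vector_derivative_nonneg_imp_le[OF t(1)])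
      fix s assume s: "0 \<le> s" "s \<le> t"
      have "((\<lambda>t. z t \<bullet> w t) has_vector_derivative z s \<bullet> (- F s) + w s \<bullet> w s) (at s within {0..t})"
        using z_within[of s t] w_within[of s t] s t
        by (intro bounded_bilinear.has_vector_derivative[OF bounded_bilinear_inner]) auto
      then show "(?h has_vector_derivative (64/49 * L\<^sup>2 * N * s\<^sup>2 - 36/49 * K * N - (z s \<bullet> (- F s) + w s \<bullet> w s)))
          (at s within {0..t})"
        by (intro has_vector_derivative_diff)
           (auto intro!: derivative_eq_intros simp flip: has_real_derivative_iff_has_vector_derivative)
      show "0 \<le> 64/49 * L\<^sup>2 * N * s\<^sup>2 - 36/49 * K * N - (z s \<bullet> (- F s) + w s \<bullet> w s)"
        using ww[of s] zF[of s] s t by simp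
    qed
    then show ?thesis by (simp add: w0)
  qed
  have "(norm (z T))\<^sup>2 \<le> N + 32/147 * L\<^sup>2 * N * T ^ 4 - 36/49 * K * N * T\<^sup>2"
  proof -
    let ?h = "\<lambda>t. 32/147 * L\<^sup>2 * N * t ^ 4 - 36/49 * K * N * t\<^sup>2 - z t \<bullet> z t"
    have "?h 0 \<le> ?h T"
    proof (rule has_vector_derivative_nonneg_imp_le[OF T])
      fix s assume s: "0 \<le> s" "s \<le> T"
      have "((\<lambda>t. z t \<bullet> z t) has_vector_derivative z s \<bullet> w s + w s \<bullet> z s) (at s within {0..T})"
        using s by (intro bounded_bilinear.has_vector_derivative[OF bounded_bilinear_inner] z)
      then show "(?h has_vector_derivative (128/147 * L\<^sup>2 * N * s ^ 3 - 72/49 * K * N * s - (z s \<bullet> w s + w s \<bullet> z s)))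
          (at s within {0..T})"
        by (intro has_vector_derivative_diff)
           (auto intro!: derivative_eq_intros simp flip: has_real_derivative_iff_has_vector_derivative)
      show "0 \<le> 128/147 * L\<^sup>2 * N * s ^ 3 - 72/49 * K * N * s - (z s \<bullet> w s + w s \<bullet> z s)"
        using zw[OF s] by (simp add: inner_commute)
    qed
    then show ?thesis by (simp add: N_def power2_norm_eq_inner)
  qed
  also have "\<dots> \<le> N - K * T\<^sup>2 / 2 * N"
  proof -
    define P Q where "P = K * T\<^sup>2 * N" and "Q = L\<^sup>2 * N * T ^ 4"
    have "(L * L * T\<^sup>2) * (N * T\<^sup>2) \<le> K * (N * T\<^sup>2)"
      using N by (intro mult_right_mono L2) auto
    then have "Q \<le> P" by (simp add: P_def Q_def power2_eq_square power4_eq_xxxx ac_simps)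
    moreover have "0 \<le> P" using K N by (simp add: P_def)
    ultimately have "N + 32/147 * Q - 36/49 * P \<le> N - 1/2 * P" by simp
    then show ?thesis by (simp add: P_def Q_def ac_simps)
  qed
  also have "\<dots> \<le> ((1 - K * T\<^sup>2 / 4) * norm (z 0))\<^sup>2"
  proof -
    have "1 - K * T\<^sup>2 / 2 \<le> (1 - K * T\<^sup>2 / 4)\<^sup>2" by (simp add: power2_diff)
    then have "(1 - K * T\<^sup>2 / 2) * N \<le> (1 - K * T\<^sup>2 / 4)\<^sup>2 * N" using N by (rule mult_right_mono)
    then show ?thesis unfolding power_mult_distrib N_def[symmetric] by (simp add: left_diff_distrib)
  qed
  finally have sq: "(norm (z T))\<^sup>2 \<le> ((1 - K * T\<^sup>2 / 4) * norm (z 0))\<^sup>2" .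
  show ?thesis
  proof (rule power2_le_imp_le[OF sq])
    show "0 \<le> (1 - K * T\<^sup>2 / 4) * norm (z 0)" using KT by simp
  qed
qed

end

section \<open>One transition step\<close>

locale hmc =
  fixes U :: "'a::euclidean_space \<Rightarrow> real" and q p :: "real \<Rightarrow> 'a \<Rightarrow> 'a \<Rightarrow> 'a" and L T :: real
  assumes flow: "hamiltonian_flow U q p"
    and Lip: "\<And>x y. norm (gradient U x - gradient U y) \<le> L * norm (x - y)"
    and T: "0 < T" and L: "0 \<le> L" and LT: "L * T\<^sup>2 \<le> 1/4"
begin

lemma difference:
  "flow_difference (\<lambda>t. q t x v - q t y v') (\<lambda>t. p t x v - p t y v')
    (\<lambda>t. gradient U (q t x v) - gradient U (q t y v')) T L"
proof
  fix t :: real assume t: "0 \<le> t" "t \<le> T"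
  have q: "((\<lambda>s. q s x v) has_vector_derivative p t x v) (at t within {0..T})"
    and p: "((\<lambda>s. p s x v) has_vector_derivative - gradient U (q t x v)) (at t within {0..T})" for x v
    using flow t unfolding hamiltonian_flow_def
    by (auto intro: has_vector_derivative_within_subset[where S="{0..}"])
  show "((\<lambda>t. q t x v - q t y v') has_vector_derivative p t x v - p t y v') (at t within {0..T})"
    by (intro has_vector_derivative_diff q)
  have "((\<lambda>t. p t x v - p t y v') has_vector_derivative
      - gradient U (q t x v) - - gradient U (q t y v')) (at t within {0..T})"
    by (intro has_vector_derivative_diff p)
  then show "((\<lambda>t. p t x v - p t y v') has_vector_derivative
      - (gradient U (q t x v) - gradient U (q t y v'))) (at t within {0..T})" by simp
qed (use Lip T L LT in auto)

lemma initial: "q 0 x v = x" "p 0 x v = v"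
  using flow by (auto simp: hamiltonian_flow_def)

lemma continuous_flow: "continuous_on UNIV (q T x)"
proof (rule lipschitz_on_continuous_on[OF lipschitz_onI])
  fix v v' :: 'a
  interpret flow_difference "\<lambda>t. q t x v - q t x v'" "\<lambda>t. p t x v - p t x v'"
    "\<lambda>t. gradient U (q t x v) - gradient U (q t x v')" T L by (rule difference)
  show "dist (q T x v) (q T x v') \<le> 8/7 * T * dist v v'"
    using norm_bounds(1)[of T] T by (simp add: initial dist_norm)
qed (use T in simp)

lemma measurable_flow [measurable]: "q T x \<in> borel_measurable borel"
  using continuous_flow by (rule borel_measurable_continuous_onI)

lemma synchronous_contraction:
  assumes A3: "assm_A3 U K R" and LK: "L * T\<^sup>2 \<le> K / L" and KT: "K * T\<^sup>2 \<le> 4" and r: "norm (x - y) \<ge> 2 * R"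
  shows "norm (q T x v - q T y v) \<le> (1 - K * T\<^sup>2 / 4) * norm (x - y)"
proof -
  interpret flow_difference "\<lambda>t. q t x v - q t y v" "\<lambda>t. p t x v - p t y v"
    "\<lambda>t. gradient U (q t x v) - gradient U (q t y v)" T L by (rule difference)
  have K: "0 < K" and R: "0 \<le> R" using A3 by (auto simp: assm_A3_def)
  have "norm (q T x v - q T y v) \<le> (1 - K * T\<^sup>2 / 4) * norm (q 0 x v - q 0 y v)"
  proof (rule contraction)
    fix t assume "6/7 * norm (q 0 x v - q 0 y v) \<le> norm (q t x v - q t y v)"
    then have "R \<le> norm (q t x v - q t y v)" using r R by (simp add: initial)
    then show "K * (norm (q t x v - q t y v))\<^sup>2
        \<le> (q t x v - q t y v) \<bullet> (gradient U (q t x v) - gradient U (q t y v))"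
      using A3 by (simp add: assm_A3_def)
  qed (use K KT LK in \<open>auto simp: initial\<close>)
  then show ?thesis by (simp add: initial)
qed

text \<open>
  Along free flight the difference \<open>x - y\<close> shrinks to \<open>(1 - \<gamma> T) (x - y)\<close>; the force contributes
  at most \<open>L T\<^sup>2 |x - y|\<close>.
\<close>

lemma shifted_velocity_distance:
  assumes \<gamma>: "0 \<le> \<gamma>" "\<gamma> * T \<le> 1"
  shows "norm (q T x w - q T y (w + \<gamma> *\<^sub>R (x - y))) \<le> (1 - \<gamma> * T + L * T\<^sup>2) * norm (x - y)"
proof -
  define v where "v = w + \<gamma> *\<^sub>R (x - y)"
  interpret flow_difference "\<lambda>t. q t x w - q t y v" "\<lambda>t. p t x w - p t y v"
    "\<lambda>t. gradient U (q t x w) - gradient U (q t y v)" T L by (rule difference)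
  have eq: "x - y + T *\<^sub>R (w - v) = (1 - \<gamma> * T) *\<^sub>R (x - y)"
    by (simp add: v_def algebra_simps)
  then have n: "norm (x - y + T *\<^sub>R (w - v)) = (1 - \<gamma> * T) * norm (x - y)" using \<gamma> by simp
  have "(1 - \<gamma> * T) * norm (x - y) \<le> 1 * norm (x - y)" using \<gamma> T by (intro mult_right_mono) auto
  then have m: "max (norm (x - y)) (norm (x - y + T *\<^sub>R (w - v))) = norm (x - y)" unfolding n by simp
  have b: "norm (q T x w - q T y v - (x - y) - T *\<^sub>R (w - v)) \<le> 4/7 * (L * T\<^sup>2) * norm (x - y)"
    using norm_bounds(2)[of T] T unfolding initial m by simp
  have "norm (q T x w - q T y v)
      = norm ((x - y + T *\<^sub>R (w - v)) + (q T x w - q T y v - (x - y) - T *\<^sub>R (w - v)))" by simp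
  also have "\<dots> \<le> (1 - \<gamma> * T) * norm (x - y) + 4/7 * (L * T\<^sup>2) * norm (x - y)"
    using b n by (intro norm_triangle_le) simp
  also have "\<dots> \<le> (1 - \<gamma> * T) * norm (x - y) + 1 * (L * T\<^sup>2) * norm (x - y)"
    using L by (intro add_left_mono mult_right_mono) auto
  finally show ?thesis by (simp add: v_def algebra_simps)
qed

text \<open>
  Free flight moves the difference along \<open>e\<close>, from \<open>r e\<close> to \<open>(r + 2 T (e \<bullet> w)) e\<close>. The hypothesis on
  \<open>e \<bullet> w\<close> keeps the last coefficient nonnegative.
\<close>

lemma reflected_velocity_distance:
  fixes x y w :: 'a
  defines "e \<equiv> sgn (x - y)" and "r \<equiv> norm (x - y)"
  assumes r: "0 < r" and \<sigma>: "- (e \<bullet> w) * T \<le> r / 2"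
  shows "norm (q T x w - q T y (w - (2 * (e \<bullet> w)) *\<^sub>R e)) \<le> 8/7 * max r (r + 2 * T * (e \<bullet> w))"
proof -
  define v where "v = w - (2 * (e \<bullet> w)) *\<^sub>R e"
  interpret flow_difference "\<lambda>t. q t x w - q t y v" "\<lambda>t. p t x w - p t y v"
    "\<lambda>t. gradient U (q t x w) - gradient U (q t y v)" T L by (rule difference)
  have z: "x - y = r *\<^sub>R e" and e: "norm e = 1" using r by (auto simp: e_def r_def sgn_div_norm)
  have eq: "x - y + T *\<^sub>R (w - v) = (r + 2 * T * (e \<bullet> w)) *\<^sub>R e"
    unfolding z by (simp add: v_def algebra_simps)
  have "norm (x - y + T *\<^sub>R (w - v)) = \<bar>r + 2 * T * (e \<bullet> w)\<bar>"
    unfolding eq by (simp only: norm_scaleR e mult_1_right)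
  also have "\<dots> = r + 2 * T * (e \<bullet> w)" using \<sigma> by (simp add: algebra_simps)
  finally have "norm (x - y + T *\<^sub>R (w - v)) = r + 2 * T * (e \<bullet> w)" .
  then show ?thesis using norm_bounds(1)[of T] T by (simp add: initial r_def v_def)
qed

end

section \<open>Expected contraction under the reflection coupling\<close>

lemma exp_five_halves: "exp (5/2 :: real) \<le> 25/2" "10 \<le> exp (5/2 :: real)"
proof -
  have "(exp (5/2 :: real))\<^sup>2 = exp 1 ^ 5" by (simp flip: exp_of_nat_mult)
  also have "\<dots> \<le> (272/100) ^ 5" using e_less_272 by (intro power_mono) auto
  also have "\<dots> \<le> (25/2)\<^sup>2" by (simp add: power_divide divide_simps)
  finally show "exp (5/2 :: real) \<le> 25/2" by (rule power2_le_imp_le) simp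
  have "10 \<le> (1 + 1/2 + (1/2)\<^sup>2 / 2 :: real) ^ 5" by (simp add: power_divide divide_simps)
  also have "\<dots> \<le> exp (1/2) ^ 5" by (intro power_mono exp_lower_Taylor_quadratic) auto
  also have "\<dots> = exp (5/2)" by (simp flip: exp_of_nat_mult)
  finally show "10 \<le> exp (5/2 :: real)" .
qed

text \<open>
  With \<open>\<sigma> = e \<bullet> \<xi>\<close> and \<open>B\<close> the event of rejection, \<open>f(D) \<le> f(r) - \<alpha>\<close> outside \<open>B\<close> and
  \<open>f(D) \<le> f(r) + \<beta> + \<kappa> max 0 (\<sigma> - 1)\<close> on \<open>B\<close>. Both are covered by \<open>f(D) \<le> f(r) - \<alpha> + W\<close>, where
  \<open>W\<close> is nonnegative and vanishes off \<open>B\<close>; its mean is a one-dimensional integral.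
\<close>

lemma (in hmc) reflection_coupling_contraction:
  fixes \<xi> :: "'w \<Rightarrow> 'a" and x y :: 'a
  defines "r \<equiv> norm (x - y)"
  assumes noise: "coupling_noise M \<xi> u" and R: "0 < R" and LTR: "L * T * R \<le> 1/16"
    and \<gamma>: "\<gamma> = min (1 / T) (1 / (4 * R))" and R1: "R\<^sub>1 = 5/2 * (R + T)"
    and r: "0 < r" "r < 2 * R"
  defines "D \<equiv> \<lambda>\<omega>. norm (q T x (\<xi> \<omega>) - q T y (coupled_velocity R \<gamma> x y (\<xi> \<omega>) (u \<omega>)))"
  shows "integrable M (\<lambda>\<omega>. profile T R\<^sub>1 (D \<omega>))"
    and "prob_space.expectation M (\<lambda>\<omega>. profile T R\<^sub>1 (D \<omega>))
      \<le> profile T R\<^sub>1 r - 1/15 * (\<gamma> * T) * (r * exp (- (r / T)))"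
proof -
  interpret prob_space M using noise by (simp add: coupling_noise_def)
  define e where "e = sgn (x - y)"
  define \<sigma> where "\<sigma> = (\<lambda>\<omega>. e \<bullet> \<xi> \<omega>)"
  define h where "h = \<gamma> * r"
  define B where "B = {\<omega>. std_normal_density (\<sigma> \<omega> + h) / std_normal_density (\<sigma> \<omega>) < u \<omega>}"
  define E where "E = exp (- (r / T))"
  define \<alpha> where "\<alpha> = (\<gamma> * T - L * T\<^sup>2) * r * E"
  define \<beta> where "\<beta> = T * E"
  define \<kappa> where "\<kappa> = 5/2 * T * exp (- (R\<^sub>1 / T))"
  define k where "k = (\<lambda>s. (\<alpha> + \<beta>) + \<kappa> * max 0 (s - 1))"
  define W where "W = (\<lambda>\<omega>. k (\<sigma> \<omega>) * indicator B \<omega>)"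
  have e: "norm e = 1" using r by (simp add: e_def r_def norm_sgn)
  have [measurable]: "\<xi> \<in> measurable M borel" "u \<in> measurable M borel"
    using noise by (auto simp: coupling_noise_def dest!: distributed_measurable)
  have [measurable]: "\<sigma> \<in> borel_measurable M" unfolding \<sigma>_def by measurable
  have [measurable]: "D \<in> borel_measurable M"
    unfolding D_def coupled_velocity_def Let_def by measurable
  have [measurable]: "k \<in> borel_measurable borel" unfolding k_def by measurable
  have E: "E > 0" by (simp add: E_def)
  have g: "0 < \<gamma>" "\<gamma> * T \<le> 1" "\<gamma> * R \<le> 1/4"
    using T R by (auto simp: \<gamma> min_def field_simps)
  have "\<gamma> * r \<le> \<gamma> * (2 * R)" using g r by (intro mult_left_mono) auto
  also have "\<dots> = 2 * (\<gamma> * R)" by simp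
  finally have "h \<le> 1/2" unfolding h_def using g(3) by linarith
  moreover have "0 < h" using g r by (simp add: h_def)
  ultimately have h: "0 < h" "h \<le> 1/2" by simp_all
  have LTg: "L * T\<^sup>2 \<le> \<gamma> * T / 4"
  proof (cases "1 / T \<le> 1 / (4 * R)")
    case True
    then show ?thesis using LT T by (simp add: \<gamma>)
  next
    case False
    then have "\<gamma> * T / 4 = T * (1/16) / R" using R by (simp add: \<gamma>)
    moreover have "L * T\<^sup>2 = T * (L * T * R) / R" using R by (simp add: power2_eq_square)
    moreover have "T * (L * T * R) / R \<le> T * (1/16) / R"
      using LTR T R by (intro divide_right_mono mult_left_mono) auto
    ultimately show ?thesis by simp
  qed
  have rR1: "r \<le> R\<^sub>1" using r T R by (simp add: R1)
  have \<alpha>: "3/4 * (\<gamma> * T * r * E) \<le> \<alpha>"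
  proof -
    have "3/4 * (\<gamma> * T) \<le> \<gamma> * T - L * T\<^sup>2" using LTg by linarith
    then have "3/4 * (\<gamma> * T) * (r * E) \<le> (\<gamma> * T - L * T\<^sup>2) * (r * E)"
      using r E by (intro mult_right_mono) auto
    then show ?thesis by (simp add: \<alpha>_def mult.assoc)
  qed
  have pos: "0 \<le> \<gamma> * T * r * E" using g T r E by simp
  have k0: "0 \<le> \<alpha> + \<beta>" "0 \<le> \<kappa>" using \<alpha> pos T E by (simp_all add: \<beta>_def \<kappa>_def)
  then have k_nonneg: "0 \<le> k s" for s by (simp add: k_def)
  have u1: "AE \<omega> in M. u \<omega> < 1"
  proof -
    have D: "distributed M lborel u (indicator {0<..<1})" using noise by (simp add: coupling_noise_def)
    have "AE t in density lborel (indicator {0<..<1::real}). t < 1" by (subst AE_density) (auto split: split_indicator)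
    then have "AE t in distr M lborel u. t < 1" unfolding distributed_distr_eq_density[OF D] .
    then show ?thesis by (subst (asm) AE_distr_iff) auto
  qed
  have pointwise: "profile T R\<^sub>1 (D \<omega>) \<le> profile T R\<^sub>1 r - \<alpha> + W \<omega>" if u: "u \<omega> < 1" for \<omega>
  proof (cases "\<omega> \<in> B")
    case False
    then have "D \<omega> = norm (q T x (\<xi> \<omega>) - q T y (\<xi> \<omega> + \<gamma> *\<^sub>R (x - y)))"
      using r by (auto simp: D_def coupled_velocity_def Let_def B_def \<sigma>_def e_def h_def r_def not_less)
    also have "\<dots> \<le> (1 - \<gamma> * T + L * T\<^sup>2) * r"
      unfolding r_def by (rule shifted_velocity_distance) (use g in auto)
    finally have "D \<omega> - r \<le> - ((\<gamma> * T - L * T\<^sup>2) * r)" by (simp add: algebra_simps)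
    then have "E * (D \<omega> - r) \<le> E * - ((\<gamma> * T - L * T\<^sup>2) * r)" using E by (intro mult_left_mono) auto
    moreover have "profile T R\<^sub>1 (D \<omega>) \<le> profile T R\<^sub>1 r + E * (D \<omega> - r)"
      using profile_concave[OF T, of R\<^sub>1 "D \<omega>" r] rR1 by (simp add: E_def)
    moreover have "E * - ((\<gamma> * T - L * T\<^sup>2) * r) = - \<alpha>" by (simp add: \<alpha>_def)
    moreover have "W \<omega> = 0" using False by (simp add: W_def)
    ultimately show ?thesis by linarith
  next
    case True
    then have D: "D \<omega> = norm (q T x (\<xi> \<omega>) - q T y (\<xi> \<omega> - (2 * (e \<bullet> \<xi> \<omega>)) *\<^sub>R e))"
      using r by (auto simp: D_def coupled_velocity_def Let_def B_def \<sigma>_def e_def h_def r_def not_less)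
    \<comment> \<open>A rejection forces the density ratio below \<open>u < 1\<close>, hence \<open>\<sigma> > - h/2\<close>.\<close>
    have "std_normal_density (\<sigma> \<omega> + h) / std_normal_density (\<sigma> \<omega>) < 1" using True u by (simp add: B_def)
    then have "\<not> std_normal_density (\<sigma> \<omega>) \<le> std_normal_density (\<sigma> \<omega> + h)"
      by (simp add: normal_density_pos)
    then have "- \<sigma> \<omega> \<le> h / 2" using h by (auto simp: std_normal_density_le_iff)
    then have "- \<sigma> \<omega> * T \<le> h / 2 * T" using T by (intro mult_right_mono) auto
    also have "\<dots> = \<gamma> * T * (r / 2)" by (simp add: h_def)
    also have "\<dots> \<le> 1 * (r / 2)" using g r by (intro mult_right_mono) auto
    finally have "- (e \<bullet> \<xi> \<omega>) * T \<le> r / 2" by (simp add: \<sigma>_def)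
    then have "D \<omega> \<le> 8/7 * max r (r + 2 * T * \<sigma> \<omega>)"
      unfolding D \<sigma>_def r_def e_def by (intro reflected_velocity_distance) (use r in \<open>auto simp: r_def\<close>)
    also have "\<dots> \<le> 5/4 * max r (r + 2 * T * \<sigma> \<omega>)" using r by (intro mult_right_mono) auto
    also have "\<dots> \<le> R\<^sub>1 + 5/2 * T * max 0 (\<sigma> \<omega> - 1)"
    proof -
      have "T * (\<sigma> \<omega> - 1) \<le> T * max 0 (\<sigma> \<omega> - 1)" "0 \<le> T * max 0 (\<sigma> \<omega> - 1)"
        using T by (auto intro!: mult_left_mono)
      then have "r + 2 * T * \<sigma> \<omega> \<le> 2 * R + 2 * T + 2 * (T * max 0 (\<sigma> \<omega> - 1))"
        "r \<le> 2 * R + 2 * T + 2 * (T * max 0 (\<sigma> \<omega> - 1))"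
        using r T unfolding right_diff_distrib by linarith+
      then have "max r (r + 2 * T * \<sigma> \<omega>) \<le> 2 * R + 2 * T + 2 * (T * max 0 (\<sigma> \<omega> - 1))" by simp
      then have "5/4 * max r (r + 2 * T * \<sigma> \<omega>) \<le> 5/4 * (2 * R + 2 * T + 2 * (T * max 0 (\<sigma> \<omega> - 1)))"
        by (rule mult_left_mono) simp
      also have "\<dots> = R\<^sub>1 + 5/2 * T * max 0 (\<sigma> \<omega> - 1)" by (simp add: R1 field_simps)
      finally show ?thesis .
    qed
    finally have "D \<omega> - R\<^sub>1 \<le> 5/2 * T * max 0 (\<sigma> \<omega> - 1)" by simp
    then have "max 0 (D \<omega> - R\<^sub>1) \<le> 5/2 * T * max 0 (\<sigma> \<omega> - 1)" using T by (intro max.boundedI) auto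
    then have "exp (- (R\<^sub>1 / T)) * max 0 (D \<omega> - R\<^sub>1) \<le> exp (- (R\<^sub>1 / T)) * (5/2 * T * max 0 (\<sigma> \<omega> - 1))"
      by (intro mult_left_mono) auto
    also have "\<dots> = \<kappa> * max 0 (\<sigma> \<omega> - 1)" by (simp add: \<kappa>_def)
    finally have "profile T R\<^sub>1 (D \<omega>) \<le> profile T R\<^sub>1 r + \<beta> + \<kappa> * max 0 (\<sigma> \<omega> - 1)"
      using profile_increment_le[OF T rR1, of "D \<omega>"] by (simp add: E_def \<beta>_def)
    then show ?thesis using True by (simp add: W_def k_def)
  qed
  define C where "C = (\<alpha> + \<beta>) * (2/5 * h) + \<kappa> * (h / 2)"
  have W_nonneg: "0 \<le> W \<omega>" for \<omega> using k_nonneg by (simp add: W_def)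
  have [measurable]: "W \<in> borel_measurable M" unfolding W_def B_def by measurable
  have "(\<integral>\<^sup>+\<omega>. ennreal (W \<omega>) \<partial>M) = (\<integral>\<^sup>+\<omega>. ennreal (k (\<sigma> \<omega>)) * indicator B \<omega> \<partial>M)"
    by (intro nn_integral_cong) (auto simp: W_def split: split_indicator)
  also have "\<dots> = (\<integral>\<^sup>+s. ennreal (k s * max 0 (std_normal_density s - std_normal_density (s + h))) \<partial>lborel)"
    unfolding B_def
  proof (rule nn_integral_rejection[OF prob_space_axioms])
    show "distributed M lborel \<sigma> (\<lambda>x. ennreal (std_normal_density x))"
      unfolding \<sigma>_def using noise e
      by (intro std_gaussian_projection prob_space_axioms) (auto simp: coupling_noise_def)
    show "distributed M lborel u (indicator {0<..<1})" using noise by (simp add: coupling_noise_def)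
    show "indep_var borel \<sigma> borel u" unfolding \<sigma>_def by (rule indep_var_of_noise[OF noise])
  qed (use k_nonneg in auto)
  also have "\<dots> \<le> ennreal C"
    unfolding k_def C_def using h k0 by (intro std_normal_excess_weighted) auto
  finally have W_le: "(\<integral>\<^sup>+\<omega>. ennreal (W \<omega>) \<partial>M) \<le> ennreal C" .
  have W: "integrable M W"
    using W_le W_nonneg by (intro integrableI_bounded) (auto simp: order_le_less_trans)
  have C: "0 \<le> C" using k0 h by (simp add: C_def)
  have EW: "expectation W \<le> C"
    using W_le nn_integral_eq_integral[OF W] W_nonneg C by (simp add: ennreal_le_iff)
  have D0: "0 \<le> profile T R\<^sub>1 (D \<omega>)" for \<omega>
    by (rule profile_nonneg) (use T rR1 r in \<open>auto simp: D_def\<close>)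
  have Wint: "integrable M (\<lambda>\<omega>. profile T R\<^sub>1 r - \<alpha> + W \<omega>)" using W by simp
  show int: "integrable M (\<lambda>\<omega>. profile T R\<^sub>1 (D \<omega>))"
  proof (rule Bochner_Integration.integrable_bound[OF Wint])
    show "AE \<omega> in M. norm (profile T R\<^sub>1 (D \<omega>)) \<le> norm (profile T R\<^sub>1 r - \<alpha> + W \<omega>)"
      using u1
    proof eventually_elim
      case (elim \<omega>)
      have "norm (profile T R\<^sub>1 (D \<omega>)) = profile T R\<^sub>1 (D \<omega>)" using D0 by simp
      also have "\<dots> \<le> profile T R\<^sub>1 r - \<alpha> + W \<omega>" by (rule pointwise[OF elim])
      also have "\<dots> \<le> norm (profile T R\<^sub>1 r - \<alpha> + W \<omega>)" by simp
      finally show ?case .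
    qed
  qed measurable
  have "expectation (\<lambda>\<omega>. profile T R\<^sub>1 (D \<omega>)) \<le> expectation (\<lambda>\<omega>. profile T R\<^sub>1 r - \<alpha> + W \<omega>)"
    using u1 pointwise by (intro integral_mono_AE int Wint) (auto elim!: eventually_mono)
  also have "\<dots> = profile T R\<^sub>1 r - \<alpha> + expectation W" using W by (simp add: prob_space)
  also have "\<dots> \<le> profile T R\<^sub>1 r - \<alpha> + C" using EW by simp
  also have "\<dots> \<le> profile T R\<^sub>1 r - 1/15 * (\<gamma> * T) * (r * E)"
  proof -
    \<comment> \<open>\<open>R\<^sub>1 / T = 5/2 + 5/2 R/T\<close>, where the second summand exceeds \<open>r/T\<close> and the first gains \<open>exp (- 5/2) \<le> 1/10\<close>.\<close>
    have "exp (- (R\<^sub>1 / T)) \<le> 1/10 * E"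
    proof -
      have "R\<^sub>1 / T = 5/2 + 5/2 * R / T" using T by (simp add: R1 field_simps)
      then have "exp (- (R\<^sub>1 / T)) = exp (- (5/2 * R / T)) / exp (5/2)" by (simp add: exp_diff[symmetric])
      also have "\<dots> \<le> E / 10"
      proof (rule frac_le)
        have "r / T \<le> 5/2 * R / T" using r R T by (intro divide_right_mono) auto
        then show "exp (- (5/2 * R / T)) \<le> E" by (simp add: E_def)
      qed (use exp_five_halves E in auto)
      finally show ?thesis by simp
    qed
    then have "5/4 * (T * \<gamma> * r) * exp (- (R\<^sub>1 / T)) \<le> 5/4 * (T * \<gamma> * r) * (1/10 * E)"
      using T g r by (intro mult_left_mono) auto
    then have 1: "\<kappa> * (h / 2) \<le> 1/8 * (\<gamma> * T * r * E)" by (simp add: \<kappa>_def h_def ac_simps)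
    have 2: "\<beta> * (2/5 * h) = 2/5 * (\<gamma> * T * r * E)" by (simp add: \<beta>_def h_def)
    have "\<alpha> * (2/5 * h) \<le> \<alpha> * (2/5 * (1/2))" using \<alpha> pos h by (intro mult_left_mono) auto
    then have "- \<alpha> + C \<le> - (1/15) * (\<gamma> * T * r * E)"
      using 1 2 \<alpha> pos unfolding C_def distrib_right by linarith
    then show ?thesis by (simp add: mult.assoc)
  qed
  finally show "expectation (\<lambda>\<omega>. profile T R\<^sub>1 (D \<omega>))
      \<le> profile T R\<^sub>1 r - 1/15 * (\<gamma> * T) * (r * exp (- (r / T)))" by (simp add: E_def)
qed

section \<open>The contraction rate\<close>

text \<open>
  With \<open>y = 5/2 (1 + \<rho>)\<close> the exponentials in \<open>c\<close> combine to
  \<open>exp (- 5/2 \<rho>) = exp (5/2) exp (- y)\<close>, and \<open>exp (5/2) \<le> 25/2\<close> is just enough.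
\<close>

lemma rate_le_synchronous:
  fixes K T \<rho> c :: real
  assumes "0 < K" "0 < T" "0 \<le> \<rho>"
    and c: "c = 1/10 * min 1 (1/2 * K * T\<^sup>2 * (1 + \<rho>) * exp (- \<rho> / 2)) * exp (- 2 * \<rho>)"
    and y: "y = 5/2 * (1 + \<rho>)"
  shows "c \<le> K * T\<^sup>2 / 4 * (y * exp (- y))"
proof -
  have "c \<le> 1/10 * (1/2 * K * T\<^sup>2 * (1 + \<rho>) * exp (- \<rho> / 2)) * exp (- 2 * \<rho>)"
    unfolding c by (intro mult_right_mono mult_left_mono) auto
  also have "\<dots> = K * T\<^sup>2 * (1 + \<rho>) / 20 * (exp (- \<rho> / 2) * exp (- 2 * \<rho>))" by simp
  also have "exp (- \<rho> / 2) * exp (- 2 * \<rho>) = exp (5/2) * exp (- y)"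
    by (simp add: exp_add[symmetric] y algebra_simps)
  also have "K * T\<^sup>2 * (1 + \<rho>) / 20 * (exp (5/2) * exp (- y)) \<le> K * T\<^sup>2 * (1 + \<rho>) / 20 * (25/2 * exp (- y))"
    using assms exp_five_halves by (intro mult_left_mono mult_right_mono) auto
  also have "\<dots> = K * T\<^sup>2 / 4 * (y * exp (- y))" by (simp add: y)
  finally show ?thesis .
qed

text \<open>
  \<open>K T\<^sup>2 (1 + R/T) \<le> 1/4 + 1/16\<close> makes \<open>c exp (2R/T)\<close> at most \<open>exp (- R/(2T)) / 64\<close>. If
  \<open>\<gamma> T = T/(4R)\<close>, the remaining exponential pays for the small value of \<open>\<gamma> T\<close>.
\<close>

lemma rate_le_reflection:
  fixes K T R c :: real
  assumes K: "0 < K" and T: "0 < T" and R: "0 < R"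
    and KT: "K * T\<^sup>2 \<le> 1/4" and KTR: "K * T * R \<le> 1/16"
    and c: "c = 1/10 * min 1 (1/2 * K * T\<^sup>2 * (1 + R / T) * exp (- (R / T) / 2)) * exp (- 2 * (R / T))"
    and \<gamma>: "\<gamma> = min (1 / T) (1 / (4 * R))"
  shows "c \<le> 1/15 * (\<gamma> * T) * exp (- 2 * (R / T))"
proof -
  define \<rho> where "\<rho> = R / T"
  have \<rho>: "0 < \<rho>" using R T by (simp add: \<rho>_def)
  have "K * T\<^sup>2 * (1 + \<rho>) = K * T\<^sup>2 + K * T * R"
    using T by (simp add: \<rho>_def power2_eq_square distrib_left)
  then have "K * T\<^sup>2 * (1 + \<rho>) \<le> 5/16" using KT KTR by simp
  then have "1/20 * (K * T\<^sup>2 * (1 + \<rho>)) * exp (- \<rho> / 2) \<le> 1/20 * (5/16) * exp (- \<rho> / 2)"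
    by (intro mult_right_mono mult_left_mono) auto
  then have *: "1/10 * (1/2 * K * T\<^sup>2 * (1 + \<rho>) * exp (- \<rho> / 2)) \<le> exp (- \<rho> / 2) / 64" by simp
  also have "\<dots> \<le> 1/15 * (\<gamma> * T)"
  proof (cases "1 / T \<le> 1 / (4 * R)")
    case True
    have "exp (- \<rho> / 2) \<le> 1" using \<rho> by simp
    moreover have "\<gamma> * T = 1" using True T by (simp add: \<gamma>)
    ultimately show ?thesis by linarith
  next
    case False
    then have g: "\<gamma> * T = 1 / (4 * \<rho>)" using T by (simp add: \<gamma> \<rho>_def)
    have "\<rho> / 2 * exp (- (\<rho> / 2)) \<le> exp (- 1)" by (rule x_exp_le)
    also have "exp (- 1) \<le> 1 / (2::real)" using exp_ge_add_one_self[of 1] by (simp add: exp_minus field_simps)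
    finally have "exp (- \<rho> / 2) \<le> 1 / \<rho>" using \<rho> by (simp add: field_simps)
    then have "exp (- \<rho> / 2) / 64 \<le> 1 / \<rho> / 64" by simp
    also have "\<dots> \<le> 1/15 * (1 / (4 * \<rho>))" using \<rho> by (simp add: field_simps)
    finally show ?thesis by (simp add: g)
  qed
  finally have "1/10 * (1/2 * K * T\<^sup>2 * (1 + \<rho>) * exp (- \<rho> / 2)) * exp (- 2 * \<rho>) \<le> 1/15 * (\<gamma> * T) * exp (- 2 * \<rho>)"
    by (rule mult_right_mono) simp
  moreover have "c \<le> 1/10 * (1/2 * K * T\<^sup>2 * (1 + \<rho>) * exp (- \<rho> / 2)) * exp (- 2 * \<rho>)"
    unfolding c \<rho>_def[symmetric] by (intro mult_right_mono mult_left_mono) auto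
  ultimately show ?thesis unfolding \<rho>_def by (rule order_trans[rotated])
qed

theorem theorem2p3:
  fixes U :: "real ^ 'd \<Rightarrow> real"
    and q p :: "real \<Rightarrow> real ^ 'd \<Rightarrow> real ^ 'd \<Rightarrow> real ^ 'd"
    and M :: "'w measure" and \<xi> :: "'w \<Rightarrow> real ^ 'd" and u :: "'w \<Rightarrow> real"
    and L K R T \<gamma> a R\<^sub>1 c :: real and f :: "real \<Rightarrow> real"
    and X' Y' :: "real ^ 'd \<Rightarrow> real ^ 'd \<Rightarrow> 'w \<Rightarrow> real ^ 'd"
    and x y :: "real ^ 'd"
  assumes "C_k 4 U"
    and "integrable lborel (\<lambda>x. exp (- U x))"
    and "assm_A1 U" and "assm_A2 U L" and "assm_A3 U K R"
    and "T > 0"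
    (* extended reals: 1 / 0 = \<infinity> when R = 0 *)
    and "ereal (L * T\<^sup>2) \<le> min (ereal (K / L)) (min (ereal (1 / 4)) (1 / ereal (256 * L * R\<^sup>2)))"
    and "ereal \<gamma> = min (ereal (1 / T)) (1 / ereal R / 4)"
    and "a = 1 / T"
    and "R\<^sub>1 = 5 / 2 * (R + T)"
    and "\<And>r. r \<ge> 0 \<Longrightarrow> f r = integral {0..r} (\<lambda>s. exp (- a * min s R\<^sub>1))"
    and "c = 1 / 10 * min 1 (1 / 2 * K * T\<^sup>2 * (1 + R / T) * exp (- R / (2 * T))) * exp (- 2 * R / T)"
    and "hamiltonian_flow U q p"
    and "coupling_noise M \<xi> u"
    and "\<And>x y \<omega>. X' x y \<omega> = q T x (\<xi> \<omega>)"
    and "\<And>x y \<omega>. Y' x y \<omega> = q T y (coupled_velocity R \<gamma> x y (\<xi> \<omega>) (u \<omega>))"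
  shows "integrable M (\<lambda>\<omega>. f (norm (X' x y \<omega> - Y' x y \<omega>))) \<and>
         prob_space.expectation M (\<lambda>\<omega>. f (norm (X' x y \<omega> - Y' x y \<omega>))) \<le> (1 - c) * f (norm (x - y))"
proof -
  note A3 = \<open>assm_A3 U K R\<close> and T = \<open>T > 0\<close> and R1 = \<open>R\<^sub>1 = 5 / 2 * (R + T)\<close>
    and flow = \<open>hamiltonian_flow U q p\<close> and noise = \<open>coupling_noise M \<xi> u\<close>
  interpret prob_space M using noise by (simp add: coupling_noise_def)
  have K: "0 < K" and R: "0 \<le> R" using A3 by (auto simp: assm_A3_def)
  have Lip: "norm (gradient U x - gradient U y) \<le> L * norm (x - y)" for x y
    by (rule gradient_Lipschitz) fact+
  have KL: "K \<le> L" by (rule convexity_le_Lipschitz[OF A3 Lip])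
  then have L_pos: "0 < L" using K by simp
  have LT2: "L * T\<^sup>2 \<le> K / L" "L * T\<^sup>2 \<le> 1/4"
    and LR: "ereal (L * T\<^sup>2) \<le> 1 / ereal (256 * L * R\<^sup>2)"
    using assms(7) by auto
  have KT: "K * T\<^sup>2 \<le> 1/4" using LT2(2) mult_right_mono[OF KL, of "T\<^sup>2"] by simp
  interpret hmc U q p L T
    using flow Lip T L_pos LT2 by unfold_locales auto
  have R1_nonneg: "0 \<le> R\<^sub>1" using R T by (simp add: R1)
  have f: "f r = profile T R\<^sub>1 r" if "0 \<le> r" for r
    using that assms(9,11) profile_eq_integral[OF T R1_nonneg that] by simp
  have c: "c = 1/10 * min 1 (1/2 * K * T\<^sup>2 * (1 + R / T) * exp (- (R / T) / 2)) * exp (- 2 * (R / T))"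
    using assms(12) by (simp add: field_simps)
  have c_nonneg: "0 \<le> c" unfolding c using K T R by (intro mult_nonneg_nonneg) auto
  define r where "r = norm (x - y)"
  have r_nonneg: "0 \<le> r" by (simp add: r_def)
  define D where "D = (\<lambda>\<omega>. norm (q T x (\<xi> \<omega>) - q T y (coupled_velocity R \<gamma> x y (\<xi> \<omega>) (u \<omega>))))"
  have [measurable]: "\<xi> \<in> measurable M borel" "u \<in> measurable M borel"
    using noise by (auto simp: coupling_noise_def dest!: distributed_measurable)
  have D_measurable [measurable]: "D \<in> borel_measurable M"
    unfolding D_def coupled_velocity_def Let_def by measurable
  have claim_of_bound: ?thesis
    if int: "integrable M (\<lambda>\<omega>. profile T R\<^sub>1 (D \<omega>))"
      and bound: "expectation (\<lambda>\<omega>. profile T R\<^sub>1 (D \<omega>)) \<le> (1 - c) * profile T R\<^sub>1 r"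
    using that by (simp add: assms(15,16) f r_def D_def)
  have claim_of_pointwise: ?thesis
    if "\<And>\<omega>. profile T R\<^sub>1 (D \<omega>) \<le> (1 - c) * profile T R\<^sub>1 r"
  proof (rule claim_of_bound)
    have "0 \<le> profile T R\<^sub>1 (D \<omega>)" for \<omega>
      using profile_nonneg[OF T R1_nonneg, of "D \<omega>"] by (simp add: D_def)
    then show "integrable M (\<lambda>\<omega>. profile T R\<^sub>1 (D \<omega>))"
      using that by (intro integrable_const_bound[of _ "(1 - c) * profile T R\<^sub>1 r"]) auto
    then have "expectation (\<lambda>\<omega>. profile T R\<^sub>1 (D \<omega>)) \<le> expectation (\<lambda>\<omega>. (1 - c) * profile T R\<^sub>1 r)"
      using that by (intro integral_mono) auto
    then show "expectation (\<lambda>\<omega>. profile T R\<^sub>1 (D \<omega>)) \<le> (1 - c) * profile T R\<^sub>1 r"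
      by (simp add: prob_space)
  qed
  consider "2 * R \<le> r" | "r = 0" | "0 < r" "r < 2 * R"
    using r_nonneg by (cases "2 * R \<le> r"; cases "r = 0") auto
  then show ?thesis
  proof cases
    case 1
    show ?thesis
    proof (rule claim_of_pointwise)
      fix \<omega>
      have "D \<omega> = norm (q T x (\<xi> \<omega>) - q T y (\<xi> \<omega>))"
        using 1 by (simp add: D_def coupled_velocity_def Let_def r_def)
      also have "\<dots> \<le> (1 - K * T\<^sup>2 / 4) * r"
        unfolding r_def using KT 1 by (intro synchronous_contraction[OF A3 LT2(1)]) (auto simp: r_def)
      finally have "exp (- (min r R\<^sub>1 / T)) * (D \<omega> - r) \<le> exp (- (min r R\<^sub>1 / T)) * - (K * T\<^sup>2 / 4 * r)"
        by (intro mult_left_mono) (auto simp: left_diff_distrib)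
      also have "\<dots> = - (K * T\<^sup>2 / 4 * (r * exp (- (min r R\<^sub>1 / T))))" by simp
      also have "\<dots> \<le> - (c * profile T R\<^sub>1 r)"
      proof -
        have "R\<^sub>1 / T = 5/2 * (1 + R / T)" using T by (simp add: R1 field_simps)
        then have "c \<le> K * T\<^sup>2 / 4 * (R\<^sub>1 / T * exp (- (R\<^sub>1 / T)))"
          using K T R by (intro rate_le_synchronous[OF _ _ _ c]) auto
        then have "c * profile T R\<^sub>1 r \<le> K * T\<^sup>2 / 4 * (R\<^sub>1 / T * exp (- (R\<^sub>1 / T))) * profile T R\<^sub>1 r"
          by (rule mult_right_mono) (rule profile_nonneg[OF T R1_nonneg r_nonneg])
        also have "\<dots> = K * T\<^sup>2 / 4 * (R\<^sub>1 / T * exp (- (R\<^sub>1 / T)) * profile T R\<^sub>1 r)" by simp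
        also have "\<dots> \<le> K * T\<^sup>2 / 4 * (r * exp (- (min r R\<^sub>1 / T)))"
          using K by (intro mult_left_mono profile_slope_ratio[OF T r_nonneg R1_nonneg]) auto
        finally show ?thesis by simp
      qed
      finally show "profile T R\<^sub>1 (D \<omega>) \<le> (1 - c) * profile T R\<^sub>1 r"
        using profile_concave[OF T, of R\<^sub>1 "D \<omega>" r] by (simp add: left_diff_distrib)
    qed
  next
    case 2
    then have "D \<omega> = 0" for \<omega> by (simp add: D_def coupled_velocity_def Let_def r_def)
    then show ?thesis using 2 R1_nonneg by (intro claim_of_pointwise) simp
  next
    case 3
    then have R0: "0 < R" using R by simp
    have "1 / ereal (256 * L * R\<^sup>2) = ereal (1 / (256 * L * R\<^sup>2))"
      using R0 L_pos by (simp add: one_ereal_def)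
    moreover have "1 / ereal R / 4 = ereal (1 / R) / ereal 4"
      using R0 by (simp add: one_ereal_def)
    then have "1 / ereal R / 4 = ereal (1 / (4 * R))" by simp
    ultimately have "ereal (L * T\<^sup>2) \<le> ereal (1 / (256 * L * R\<^sup>2))"
      "ereal \<gamma> = min (ereal (1 / T)) (ereal (1 / (4 * R)))"
      using LR assms(8) by simp_all
    then have LR': "L * T\<^sup>2 \<le> 1 / (256 * L * R\<^sup>2)" and \<gamma>: "\<gamma> = min (1 / T) (1 / (4 * R))"
      by (auto simp: min_def split: if_splits)
    \<comment> \<open>The third bound on \<open>L T\<^sup>2\<close> is used in the form \<open>L T R \<le> 1/16\<close>.\<close>
    have "(L * T * R)\<^sup>2 = L * T\<^sup>2 * (L * R\<^sup>2)" by (simp add: power2_eq_square)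
    also have "\<dots> \<le> 1 / (256 * L * R\<^sup>2) * (L * R\<^sup>2)" using L_pos by (intro mult_right_mono LR') auto
    also have "\<dots> = (1/16)\<^sup>2" using L_pos R0 by (simp add: power2_eq_square)
    finally have LTR: "L * T * R \<le> 1/16" by (rule power2_le_imp_le) simp
    have "K * (T * R) \<le> L * (T * R)" using KL T R0 by (intro mult_right_mono) auto
    then have KTR: "K * T * R \<le> 1/16" using LTR by simp
    have D_eq: "norm (q T x (\<xi> \<omega>) - q T y (coupled_velocity R \<gamma> x y (\<xi> \<omega>) (u \<omega>))) = D \<omega>" for \<omega>
      by (simp add: D_def)
    note R = reflection_coupling_contraction[OF noise R0 LTR \<gamma> R1, of x y, folded r_def, OF 3, unfolded D_eq]
    show ?thesis
    proof (rule claim_of_bound)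
      show "integrable M (\<lambda>\<omega>. profile T R\<^sub>1 (D \<omega>))" by (rule R(1))
      have "c * profile T R\<^sub>1 r \<le> c * r"
        by (intro mult_left_mono profile_le T R1_nonneg c_nonneg)
      also have "\<dots> \<le> 1/15 * (\<gamma> * T) * exp (- 2 * (R / T)) * r"
        using 3 by (intro mult_right_mono rate_le_reflection[OF K T R0 KT KTR c \<gamma>]) auto
      also have "\<dots> = 1/15 * (\<gamma> * T) * r * exp (- 2 * (R / T))" by simp
      also have "\<dots> \<le> 1/15 * (\<gamma> * T) * r * exp (- (r / T))"
      proof (rule mult_left_mono)
        have "r / T \<le> 2 * R / T" using 3 T by (intro divide_right_mono) auto
        then show "exp (- 2 * (R / T)) \<le> exp (- (r / T))" by simp
        show "0 \<le> 1/15 * (\<gamma> * T) * r" using T R0 3 by (simp add: \<gamma>)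
      qed
      finally have "c * profile T R\<^sub>1 r \<le> 1/15 * (\<gamma> * T) * (r * exp (- (r / T)))" by simp
      then show "expectation (\<lambda>\<omega>. profile T R\<^sub>1 (D \<omega>)) \<le> (1 - c) * profile T R\<^sub>1 r"
        using R(2) by (simp add: left_diff_distrib)
    qed
  qed
qed

end
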